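(* Let $(M,F)$ be a Finsler surface with nonflat geodesic spray $S$, and let $(X_1,X_2,X_3,X_4)=(H,S,V,\mathcal{C})$ be its Berwald frame, with dual coframe $\{\eta^i,\ 1\le i\le 4\}$. Let $\mathcal{F}:=H(\mathcal{I})+V(\mathcal{J})$. The nonvanishing components of the Berwald curvature $2$-forms $\Omega^i_j$, $1\le i,j\le 2$, are $$\Omega_1^1=V(\rho)\,\eta^1\wedge\eta^2-\mathcal{F}\,\eta^1\wedge\eta^3,\qquad \Omega_1^2=-\rho\,\eta^1\wedge\eta^2+2\,\mathcal{J}\,\eta^1\wedge\eta^3,\qquad \Omega_2^1=\rho\,\eta^1\wedge\eta^2 .$$
   Context: $M$ is a $2$-dimensional smooth manifold, $\mathcal{T}M$ its tangent bundle with the zero section removed, with induced coordinates $(x^i,y^i)$; $J=\frac{\partial}{\partial y^i}\otimes dx^i$ is the almost-tangent structure and $\mathcal{C}=y^i\frac{\partial}{\partial y^i}$ the Liouville vector field. $F:TM\to\mathbb{R}$ is a Finsler function: smooth and positive on $\mathcal{T}M$, zero exactly on the zero section, positively $1$-homogeneous in $y$, with $g_{ij}=\frac12\frac{\partial^2F^2}{\partial y^i\partial y^j}$ of maximal rank on $\mathcal{T}M$. $S=y^i\frac{\partial}{\partial x^i}-2G^i\frac{\partial}{\partial y^i}$ is its geodesic spray, $h=\frac12(Id+[J,S])$ and $v=\frac12(Id-[J,S])$ (Frölicher–Nijenhuis bracket) are the horizontal and vertical projectors. With $G^i_j=\partial G^i/\partial y^j$, the Jacobi endomorphism is $\Phi=\big(2\frac{\partial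 G^i}{\partial x^j}-S(G^i_j)-G^i_kG^k_j\big)\frac{\partial}{\partial y^i}\otimes dx^j$; in dimension $2$ one has $\Phi=K(F^2J-F\,d_JF\otimes\mathcal{C})$, where $K\in C^\infty(\mathcal{T}M)$ is the flag curvature; the Ricci scalar is $\rho=KF^2$. $S$ is nonflat: $K$ vanishes nowhere on $\mathcal{T}M$. Berwald frame: $H$ is a horizontal vector field on $\mathcal{T}M$ with $[\mathcal{C},H]=H$, $d_JF(H)=0$, $V:=JH$, normalized so that $[S,H]=\rho V$, $[V,S]=H$, $[H,V]=S+\mathcal{I}H+\mathcal{J}V$ with $\mathcal{J}=S(\mathcal{I})$. Here $\mathcal{I}$ is the main (Cartan) scalar and $\mathcal{J}$ the Landsberg scalar; $\mathcal{C}(\mathcal{I})=0$ and $\mathcal{C}(\mathcal{J})=\mathcal{J}$; also $[\mathcal{C},S]=S$, $[\mathcal{C},V]=0$. $(H,S,V,\mathcal{C})$ is a global frame on $\mathcal{T}M$. Berwald connection: $D_XY=v[hX,vY]+h[vX,hY]+J[vX,\theta Y]+\theta[hX,JY]$ with $\theta=h\circ[S,h]$. Its curvature is $R(X,Y)Z=D_XD_YZ-D_YD_XZ-D_{[X,Y]}Z$, and the curvature $2$-forms are $\Omega^i_j(X,Y)=\eta^i(R(X,Y)X_j)$. The full $4\times4$ matrix of curvature $2$-forms is block diagonal with two equal $2\times 2$ blocks, so only $1\le i,j\le2$ is listed. Convention: $(\eta^a\wedge\eta^b)(X_a,X_b)=1$ for $a\ne b$. *)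

theory Defs
  imports "HOL-Analysis.Analysis" "HOL-Library.Function_Algebras"
begin

section \<open>Smooth functions and smooth manifolds\<close>

text \<open>On a finite-dimensional domain, \<open>C\<^sup>k\<^sup>+\<^sup>1\<close> means: differentiable, with all directional
  derivatives of class \<open>C\<^sup>k\<close>.\<close>

primrec Ck_on :: "nat \<Rightarrow> 'a::euclidean_space set \<Rightarrow> ('a \<Rightarrow> 'b::real_normed_vector) \<Rightarrow> bool" where
  "Ck_on 0 U f \<longleftrightarrow> continuous_on U f"
| "Ck_on (Suc k) U f \<longleftrightarrow> (\<forall>x\<in>U. f differentiable (at x)) \<and>
     (\<forall>v. Ck_on k U (\<lambda>x. frechet_derivative f (at x) v))"

definition smooth_on :: "'a::euclidean_space set \<Rightarrow> ('a \<Rightarrow> 'b::real_normed_vector) \<Rightarrow> bool" where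
  "smooth_on U f \<longleftrightarrow> open U \<and> (\<forall>k. Ck_on k U f)"

text \<open>A chart is its domain together with a coordinate map, of which only the values on the
  domain matter. The manifold described by an atlas is the union of the chart domains.\<close>

type_synonym ('a, 'e) chart = "'a set \<times> ('a \<Rightarrow> 'e)"

definition chart_inv :: "('a, 'e) chart \<Rightarrow> 'e \<Rightarrow> 'a" where
  "chart_inv c = inv_into (fst c) (snd c)"

definition carrier :: "('a, 'e) chart set \<Rightarrow> 'a set" where
  "carrier A = (\<Union>c\<in>A. fst c)"

definition smooth_atlas ::
    "('a::{t2_space, second_countable_topology}, 'e::euclidean_space) chart set \<Rightarrow> bool" where
  "smooth_atlas A \<longleftrightarrow>
     (\<forall>c\<in>A. open (fst c) \<and> open (snd c ` fst c) \<and>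
        homeomorphism (fst c) (snd c ` fst c) (snd c) (chart_inv c)) \<and>
     (\<forall>c\<in>A. \<forall>d\<in>A. smooth_on (snd c ` (fst c \<inter> fst d)) (snd d \<circ> chart_inv c))"

text \<open>The notions below use the atlas only, not a topology on the type \<open>'a\<close>; hence they also apply
  to the tangent bundle with its induced charts.\<close>

definition smooth_near :: "('a, 'e::euclidean_space) chart set \<Rightarrow> ('a \<Rightarrow> real) \<Rightarrow> 'a \<Rightarrow> bool" where
  "smooth_near A f p \<longleftrightarrow> (\<exists>c\<in>A. p \<in> fst c \<and>
     (\<exists>W. snd c p \<in> W \<and> W \<subseteq> snd c ` fst c \<and> smooth_on W (f \<circ> chart_inv c)))"

definition smooth_fun :: "('a, 'e::euclidean_space) chart set \<Rightarrow> ('a \<Rightarrow> real) \<Rightarrow> bool" where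
  "smooth_fun A f \<longleftrightarrow> (\<forall>p\<in>carrier A. smooth_near A f p)"


section \<open>Tangent vectors and vector fields\<close>

text \<open>A tangent vector at \<open>p\<close> is a first-order operator \<open>\<Sum>\<^sub>i e\<^sup>i \<partial>/\<partial>x\<^sup>i\<close> at \<open>p\<close> on the functions that are
  smooth near \<open>p\<close>; by convention it sends all other functions to \<open>0\<close>, so that tangent vectors are
  determined by their values on smooth functions. Likewise a vector field vanishes off the
  carrier. Linear operations on vectors and fields are the pointwise ones of
  \<^theory>\<open>HOL-Library.Function_Algebras\<close>.\<close>

type_synonym 'a tvector = "('a \<Rightarrow> real) \<Rightarrow> real"
type_synonym 'a vfield = "'a \<Rightarrow> 'a tvector"

definition coord_vec ::
    "('a, 'e::euclidean_space) chart set \<Rightarrow> ('a, 'e) chart \<Rightarrow> 'e \<Rightarrow> 'a vfield" where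
  "coord_vec A c e = (\<lambda>p f. if p \<in> fst c \<and> smooth_near A f p
     then frechet_derivative (f \<circ> chart_inv c) (at (snd c p)) e else 0)"

definition tangent_space :: "('a, 'e::euclidean_space) chart set \<Rightarrow> 'a \<Rightarrow> 'a tvector set" where
  "tangent_space A p = {coord_vec A c e p | c e. c \<in> A \<and> p \<in> fst c}"

definition vector_field :: "('a, 'e::euclidean_space) chart set \<Rightarrow> 'a vfield \<Rightarrow> bool" where
  "vector_field A X \<longleftrightarrow>
     (\<forall>p\<in>carrier A. X p \<in> tangent_space A p) \<and> (\<forall>p. p \<notin> carrier A \<longrightarrow> X p = 0) \<and>
     (\<forall>f p. smooth_near A f p \<longrightarrow> smooth_near A (\<lambda>q. X q f) p)"

definition vscale :: "('a \<Rightarrow> real) \<Rightarrow> 'a vfield \<Rightarrow> 'a vfield" (infixr "\<cdot>" 75) where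
  "f \<cdot> X = (\<lambda>p g. f p * X p g)"

definition vapply :: "'a vfield \<Rightarrow> ('a \<Rightarrow> real) \<Rightarrow> 'a \<Rightarrow> real" where
  "vapply X f = (\<lambda>p. X p f)"

definition lie :: "('a, 'e::euclidean_space) chart set \<Rightarrow> 'a vfield \<Rightarrow> 'a vfield \<Rightarrow> 'a vfield" where
  "lie A X Y = (\<lambda>p f. if smooth_near A f p
     then X p (vapply Y f) - Y p (vapply X f) else 0)"

definition one_form :: "('a, 'e::euclidean_space) chart set \<Rightarrow> ('a \<Rightarrow> 'a tvector \<Rightarrow> real) \<Rightarrow> bool" where
  "one_form A \<eta> \<longleftrightarrow>
     (\<forall>p\<in>carrier A. \<forall>v\<in>tangent_space A p. \<forall>w\<in>tangent_space A p. \<forall>a b.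
        \<eta> p (\<lambda>f. a * v f + b * w f) = a * \<eta> p v + b * \<eta> p w) \<and>
     (\<forall>X. vector_field A X \<longrightarrow> smooth_fun A (\<lambda>p. \<eta> p (X p)))"

definition wedge :: "('a \<Rightarrow> 'a tvector \<Rightarrow> real) \<Rightarrow> ('a \<Rightarrow> 'a tvector \<Rightarrow> real) \<Rightarrow>
    'a vfield \<Rightarrow> 'a vfield \<Rightarrow> 'a \<Rightarrow> real" where
  "wedge \<alpha> \<beta> X Y = (\<lambda>p. \<alpha> p (X p) * \<beta> p (Y p) - \<alpha> p (Y p) * \<beta> p (X p))"

definition frame :: "('a, 'e::euclidean_space) chart set \<Rightarrow> 'i set \<Rightarrow> ('i \<Rightarrow> 'a vfield) \<Rightarrow> bool" where
  "frame A I X \<longleftrightarrow> (\<forall>i\<in>I. vector_field A (X i)) \<and>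
     (\<forall>p\<in>carrier A.
        (\<forall>a::'i \<Rightarrow> real. (\<forall>f. (\<Sum>i\<in>I. a i * X i p f) = 0) \<longrightarrow> (\<forall>i\<in>I. a i = 0)) \<and>
        (\<forall>v\<in>tangent_space A p. \<exists>a::'i \<Rightarrow> real. v = (\<lambda>f. \<Sum>i\<in>I. a i * X i p f)))"

definition dual_coframe :: "('a, 'e::euclidean_space) chart set \<Rightarrow> 'i set \<Rightarrow> ('i \<Rightarrow> 'a vfield) \<Rightarrow>
    ('i \<Rightarrow> 'a \<Rightarrow> 'a tvector \<Rightarrow> real) \<Rightarrow> bool" where
  "dual_coframe A I X \<eta> \<longleftrightarrow> (\<forall>i\<in>I. one_form A (\<eta> i)) \<and>
     (\<forall>p\<in>carrier A. \<forall>i\<in>I. \<forall>j\<in>I. \<eta> i p (X j p) = (if i = j then 1 else 0))"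

text \<open>The Froelicher--Nijenhuis brackets \<open>[Y, K]\<close> (which is the Lie derivative of \<open>K\<close> along \<open>Y\<close>) and
  \<open>[K, Y] = - [Y, K]\<close> of a vector field \<open>Y\<close> and a vector-valued 1-form \<open>K\<close>, the latter viewed as an
  operator on vector fields.\<close>

definition fn_left :: "('a, 'e::euclidean_space) chart set \<Rightarrow> 'a vfield \<Rightarrow>
    ('a vfield \<Rightarrow> 'a vfield) \<Rightarrow> 'a vfield \<Rightarrow> 'a vfield" where
  "fn_left A Y K X = lie A Y (K X) - K (lie A Y X)"

definition fn_right :: "('a, 'e::euclidean_space) chart set \<Rightarrow> ('a vfield \<Rightarrow> 'a vfield) \<Rightarrow>
    'a vfield \<Rightarrow> 'a vfield \<Rightarrow> 'a vfield" where
  "fn_right A K Y X = lie A (K X) Y - K (lie A X Y)"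


section \<open>The tangent bundle of a surface\<close>

text \<open>Throughout, \<open>A\<close> is a smooth atlas of the surface \<open>M\<close>. A point of \<open>TM\<close> is a pair \<open>(p, v)\<close> with
  \<open>v\<close> tangent at \<open>p\<close>; the slit tangent bundle is the manifold given by \<open>slit_atlas A\<close>, the set of the
  induced charts \<open>(x\<^sup>i, y\<^sup>i)\<close>, where \<open>y\<^sup>i (p, v) = v x\<^sup>i\<close>.\<close>

type_synonym 'm tpoint = "'m \<times> 'm tvector"
type_synonym 'm tchart = "('m tpoint, (real^2) \<times> (real^2)) chart"

definition tangent_bundle :: "('m, real^2) chart set \<Rightarrow> 'm tpoint set" where
  "tangent_bundle A = {(p, v). p \<in> carrier A \<and> v \<in> tangent_space A p}"

definition slit_chart :: "('m, real^2) chart set \<Rightarrow> ('m, real^2) chart \<Rightarrow> 'm tchart" where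
  "slit_chart A c =
     ({(p, v). p \<in> fst c \<and> v \<in> tangent_space A p \<and> v \<noteq> 0},
      (\<lambda>(p, v). (snd c p, \<chi> i. v (\<lambda>q. snd c q $ i))))"

definition slit_atlas :: "('m, real^2) chart set \<Rightarrow> 'm tchart set" where
  "slit_atlas A = slit_chart A ` A"

definition x_coord :: "('m, real^2) chart \<Rightarrow> 2 \<Rightarrow> 'm tpoint \<Rightarrow> real" where
  "x_coord c i = (\<lambda>(p, v). snd c p $ i)"

definition y_coord :: "('m, real^2) chart \<Rightarrow> 2 \<Rightarrow> 'm tpoint \<Rightarrow> real" where
  "y_coord c i = (\<lambda>(p, v). v (\<lambda>q. snd c q $ i))"

text \<open>The coordinate fields \<open>\<partial>/\<partial>x\<^sup>i\<close> and \<open>\<partial>/\<partial>y\<^sup>i\<close> of the chart induced by \<open>c\<close>.\<close>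

definition d_x :: "('m, real^2) chart set \<Rightarrow> ('m, real^2) chart \<Rightarrow> 2 \<Rightarrow> 'm tpoint vfield" where
  "d_x A c i = coord_vec (slit_atlas A) (slit_chart A c) (axis i 1, 0)"

definition d_y :: "('m, real^2) chart set \<Rightarrow> ('m, real^2) chart \<Rightarrow> 2 \<Rightarrow> 'm tpoint vfield" where
  "d_y A c i = coord_vec (slit_atlas A) (slit_chart A c) (0, axis i 1)"

text \<open>Tensors given by a coordinate formula are evaluated at \<open>u = (p, v)\<close> in a chosen chart around \<open>p\<close>;
  the formulas below do not depend on this choice.\<close>

definition chart_at :: "('m, real^2) chart set \<Rightarrow> 'm tpoint \<Rightarrow> ('m, real^2) chart" where
  "chart_at A u = (SOME c. c \<in> A \<and> fst u \<in> fst c)"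

definition almost_tangent ::
    "('m, real^2) chart set \<Rightarrow> 'm tpoint vfield \<Rightarrow> 'm tpoint vfield" where
  "almost_tangent A X = (\<lambda>u f. let c = chart_at A u in
     \<Sum>i\<in>UNIV. X u (x_coord c i) * d_y A c i u f)"

definition liouville :: "('m, real^2) chart set \<Rightarrow> 'm tpoint vfield" where
  "liouville A = (\<lambda>u f. let c = chart_at A u in \<Sum>i\<in>UNIV. y_coord c i u * d_y A c i u f)"


section \<open>Finsler functions and their geodesic sprays\<close>

definition metric_tensor :: "('m, real^2) chart set \<Rightarrow> ('m tpoint \<Rightarrow> real) \<Rightarrow>
    ('m, real^2) chart \<Rightarrow> 'm tpoint \<Rightarrow> real^2^2" where
  "metric_tensor A F c u =
     (\<chi> i j. 1/2 * d_y A c i u (vapply (d_y A c j) (\<lambda>w. (F w)^2)))"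

definition finsler_function :: "('m, real^2) chart set \<Rightarrow> ('m tpoint \<Rightarrow> real) \<Rightarrow> bool" where
  "finsler_function A F \<longleftrightarrow>
     smooth_fun (slit_atlas A) F \<and>
     (\<forall>u\<in>carrier (slit_atlas A). F u > 0) \<and>
     (\<forall>(p, v)\<in>tangent_bundle A. F (p, v) = 0 \<longleftrightarrow> v = 0) \<and>
     (\<forall>(p, v)\<in>tangent_bundle A. \<forall>l>0. F (p, \<lambda>f. l * v f) = l * F (p, v)) \<and>
     (\<forall>c\<in>A. \<forall>u\<in>fst (slit_chart A c). rank (metric_tensor A F c u) = 2)"

definition spray :: "('m, real^2) chart set \<Rightarrow> 'm tpoint vfield \<Rightarrow> bool" where
  "spray A S \<longleftrightarrow> vector_field (slit_atlas A) S \<and>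
     almost_tangent A S = liouville A \<and> lie (slit_atlas A) (liouville A) S = S"

text \<open>The geodesic spray is the spray whose geodesics are the extremals of \<open>F\<^sup>2\<close>: it satisfies the
  Euler--Lagrange equations \<open>S(\<partial>F\<^sup>2/\<partial>y\<^sup>i) = \<partial>F\<^sup>2/\<partial>x\<^sup>i\<close>.\<close>

definition geodesic_spray ::
    "('m, real^2) chart set \<Rightarrow> ('m tpoint \<Rightarrow> real) \<Rightarrow> 'm tpoint vfield \<Rightarrow> bool" where
  "geodesic_spray A F S \<longleftrightarrow> spray A S \<and>
     (\<forall>c\<in>A. \<forall>u\<in>fst (slit_chart A c). \<forall>i.
        S u (vapply (d_y A c i) (\<lambda>w. (F w)^2)) = d_x A c i u (\<lambda>w. (F w)^2))"

definition hor :: "('m, real^2) chart set \<Rightarrow> 'm tpoint vfield \<Rightarrow>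
    'm tpoint vfield \<Rightarrow> 'm tpoint vfield" where
  "hor A S X = (\<lambda>_. 1/2) \<cdot> (X + fn_right (slit_atlas A) (almost_tangent A) S X)"

definition ver :: "('m, real^2) chart set \<Rightarrow> 'm tpoint vfield \<Rightarrow>
    'm tpoint vfield \<Rightarrow> 'm tpoint vfield" where
  "ver A S X = (\<lambda>_. 1/2) \<cdot> (X - fn_right (slit_atlas A) (almost_tangent A) S X)"

text \<open>The spray coefficients \<open>G\<^sup>i\<close>, read off from \<open>S = y\<^sup>i \<partial>/\<partial>x\<^sup>i - 2 G\<^sup>i \<partial>/\<partial>y\<^sup>i\<close>, and
  \<open>G\<^sup>i\<^sub>j = \<partial>G\<^sup>i/\<partial>y\<^sup>j\<close>.\<close>

definition spray_coeff :: "'m tpoint vfield \<Rightarrow> ('m, real^2) chart \<Rightarrow> 2 \<Rightarrow> 'm tpoint \<Rightarrow> real" where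
  "spray_coeff S c i = (\<lambda>u. - 1/2 * S u (y_coord c i))"

definition conn_coeff :: "('m, real^2) chart set \<Rightarrow> 'm tpoint vfield \<Rightarrow> ('m, real^2) chart \<Rightarrow>
    2 \<Rightarrow> 2 \<Rightarrow> 'm tpoint \<Rightarrow> real" where
  "conn_coeff A S c i j = vapply (d_y A c j) (spray_coeff S c i)"

definition jacobi_coeff :: "('m, real^2) chart set \<Rightarrow> 'm tpoint vfield \<Rightarrow> ('m, real^2) chart \<Rightarrow>
    2 \<Rightarrow> 2 \<Rightarrow> 'm tpoint \<Rightarrow> real" where
  "jacobi_coeff A S c i j = (\<lambda>u. 2 * d_x A c j u (spray_coeff S c i) - S u (conn_coeff A S c i j)
     - (\<Sum>k\<in>UNIV. conn_coeff A S c i k u * conn_coeff A S c k j u))"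

definition jacobi_endo :: "('m, real^2) chart set \<Rightarrow> 'm tpoint vfield \<Rightarrow>
    'm tpoint vfield \<Rightarrow> 'm tpoint vfield" where
  "jacobi_endo A S X = (\<lambda>u f. let c = chart_at A u in
     \<Sum>i\<in>UNIV. \<Sum>j\<in>UNIV. jacobi_coeff A S c i j u * X u (x_coord c j) * d_y A c i u f)"

definition d_J :: "('m, real^2) chart set \<Rightarrow> ('m tpoint \<Rightarrow> real) \<Rightarrow>
    'm tpoint vfield \<Rightarrow> 'm tpoint \<Rightarrow> real" where
  "d_J A f X = vapply (almost_tangent A X) f"

definition flag_curvature :: "('m, real^2) chart set \<Rightarrow> ('m tpoint \<Rightarrow> real) \<Rightarrow>
    'm tpoint vfield \<Rightarrow> ('m tpoint \<Rightarrow> real) \<Rightarrow> bool" where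
  "flag_curvature A F S K \<longleftrightarrow> smooth_fun (slit_atlas A) K \<and>
     (\<forall>X. vector_field (slit_atlas A) X \<longrightarrow>
        jacobi_endo A S X =
          K \<cdot> ((\<lambda>u. (F u)^2) \<cdot> almost_tangent A X - (\<lambda>u. F u * d_J A F X u) \<cdot> liouville A))"

definition ricci_scalar :: "('m tpoint \<Rightarrow> real) \<Rightarrow> ('m tpoint \<Rightarrow> real) \<Rightarrow> 'm tpoint \<Rightarrow> real" where
  "ricci_scalar F K = (\<lambda>u. K u * (F u)^2)"


section \<open>The Berwald frame and the Berwald connection\<close>

definition berwald_fields :: "('m, real^2) chart set \<Rightarrow> 'm tpoint vfield \<Rightarrow> 'm tpoint vfield \<Rightarrow>
    'm tpoint vfield \<Rightarrow> nat \<Rightarrow> 'm tpoint vfield" where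
  "berwald_fields A H S V i = [H, S, V, liouville A] ! (i - 1)"

text \<open>\<open>\<I>\<close> is the main (Cartan) scalar and \<open>\<J>\<close> the Landsberg scalar.\<close>

definition berwald_frame :: "('m, real^2) chart set \<Rightarrow> ('m tpoint \<Rightarrow> real) \<Rightarrow> 'm tpoint vfield \<Rightarrow>
    ('m tpoint \<Rightarrow> real) \<Rightarrow> 'm tpoint vfield \<Rightarrow> 'm tpoint vfield \<Rightarrow>
    ('m tpoint \<Rightarrow> real) \<Rightarrow> ('m tpoint \<Rightarrow> real) \<Rightarrow> bool" where
  "berwald_frame A F S \<rho> H V \<I> \<J> \<longleftrightarrow>
     (let N = slit_atlas A in
      vector_field N H \<and> hor A S H = H \<and> lie N (liouville A) H = H \<and>
      (\<forall>u\<in>carrier N. d_J A F H u = 0) \<and>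
      V = almost_tangent A H \<and>
      smooth_fun N \<I> \<and> \<J> = vapply S \<I> \<and>
      lie N S H = \<rho> \<cdot> V \<and>
      lie N V S = H \<and>
      lie N H V = S + \<I> \<cdot> H + \<J> \<cdot> V \<and>
      frame N {1..4} (berwald_fields A H S V))"

definition theta :: "('m, real^2) chart set \<Rightarrow> 'm tpoint vfield \<Rightarrow>
    'm tpoint vfield \<Rightarrow> 'm tpoint vfield" where
  "theta A S X = hor A S (fn_left (slit_atlas A) S (hor A S) X)"

definition berwald_conn :: "('m, real^2) chart set \<Rightarrow> 'm tpoint vfield \<Rightarrow>
    'm tpoint vfield \<Rightarrow> 'm tpoint vfield \<Rightarrow> 'm tpoint vfield" where
  "berwald_conn A S X Y = (let N = slit_atlas A; h = hor A S; v = ver A S;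
       \<theta> = theta A S; J = almost_tangent A in
     v (lie N (h X) (v Y)) + h (lie N (v X) (h Y)) + J (lie N (v X) (\<theta> Y)) + \<theta> (lie N (h X) (J Y)))"

definition berwald_curv :: "('m, real^2) chart set \<Rightarrow> 'm tpoint vfield \<Rightarrow>
    'm tpoint vfield \<Rightarrow> 'm tpoint vfield \<Rightarrow> 'm tpoint vfield \<Rightarrow> 'm tpoint vfield" where
  "berwald_curv A S X Y Z = (let D = berwald_conn A S in
     D X (D Y Z) - D Y (D X Z) - D (lie (slit_atlas A) X Y) Z)"

text \<open>\<open>curv_form A S E \<eta> i j\<close> is \<open>\<Omega>\<^sup>i\<^sub>j\<close>: the first index is the upper one.\<close>

definition curv_form :: "('m, real^2) chart set \<Rightarrow> 'm tpoint vfield \<Rightarrow> ('i \<Rightarrow> 'm tpoint vfield) \<Rightarrow>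
    ('i \<Rightarrow> 'm tpoint \<Rightarrow> 'm tpoint tvector \<Rightarrow> real) \<Rightarrow> 'i \<Rightarrow> 'i \<Rightarrow>
    'm tpoint vfield \<Rightarrow> 'm tpoint vfield \<Rightarrow> 'm tpoint \<Rightarrow> real" where
  "curv_form A S E \<eta> i j X Y = (\<lambda>u. \<eta> i u (berwald_curv A S X Y (E j) u))"

end

theory Submission
  imports Defs
begin

text \<open>In the Berwald frame the horizontal projector is the projection to \<open>H\<close>, \<open>S\<close> along \<open>V\<close>, \<open>C\<close>, the
  structure \<open>J\<close> maps \<open>H\<close>, \<open>S\<close> to \<open>V\<close>, \<open>C\<close> and these to zero, and \<open>\<theta>\<close> maps \<open>V\<close>, \<open>C\<close> back to \<open>H\<close>, \<open>S\<close>. Together with the brackets of the frame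
  this determines the connection forms of the Berwald connection on the horizontal fields
  (\<open>berwald_conn_comb\<close>):
  \<open>\<omega>\<^sup>1\<^sub>1 = \<J>\<eta>\<^sup>1 - \<I>\<eta>\<^sup>3 + \<eta>\<^sup>4\<close>, \<open>\<omega>\<^sup>2\<^sub>1 = -\<eta>\<^sup>3\<close>, \<open>\<omega>\<^sup>1\<^sub>2 = \<eta>\<^sup>3\<close>, \<open>\<omega>\<^sup>2\<^sub>2 = \<eta>\<^sup>4\<close>.
  The curvature forms follow from \<open>\<Omega> = d\<omega> + \<omega> \<and> \<omega>\<close>, where \<open>d\<close> is evaluated with the brackets of the frame
  (\<open>berwald_curv_comb\<close>). The derivatives of the scalars in the result are rewritten by
  Jacobi identities: the one for \<open>S\<close>, \<open>H\<close>, \<open>V\<close> gives \<open>V(\<rho>) = - \<rho>\<I> - S(\<J>)\<close> (\<open>V_rho\<close>), and the one for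
  \<open>C\<close>, \<open>H\<close>, \<open>V\<close> gives \<open>C(\<I>) = 0\<close> and \<open>C(\<J>) = \<J>\<close> (\<open>homogeneity\<close>).

  One bracket does not come with the frame, namely \<open>[C, V] = 0\<close>. It expresses that \<open>J\<close> is homogeneous
  of degree \<open>-1\<close> in the fibres and is proved by evaluation on the induced coordinates
  (\<open>lie_liouville_vertical\<close>). For this a bracket of vector fields must be determined by its values on
  coordinates (\<open>lie_in_coordinates\<close>), which follows from the symmetry of second derivatives
  (\<open>smooth_on_second_derivative_symmetric\<close>), and the induced charts must form an atlas
  (\<open>chart_system_slit_atlas\<close>).

  Arbitrary vector fields are written in the frame with smooth coefficients (\<open>comb\<close>). Brackets of such
  combinations are given by the Leibniz rule (\<open>lie_comb\<close>); apart from \<open>[C, V] = 0\<close> the computation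
  uses no coordinates, only that tangent vectors are local derivations.\<close>

section \<open>Calculus of smooth maps\<close>

lemma frechet_eqI: "(f has_derivative f') (at x) \<Longrightarrow> frechet_derivative f (at x) = f'"
  by (metis frechet_derivative_at)

lemma frechet_derivative_cong_open:
  assumes "open U" "x \<in> U" "\<And>y. y \<in> U \<Longrightarrow> f y = g y" "f differentiable (at x)"
  shows "frechet_derivative f (at x) = frechet_derivative g (at x)"
  using assms by (intro frechet_derivative_transform_within_open) auto

text \<open>The set must be open: differentiability and derivatives in \<open>Ck_on\<close> are those of the full space at the
  points of the set, so they depend on values near each point.\<close>

lemma Ck_on_cong:
  assumes "open U" "\<And>x. x \<in> U \<Longrightarrow> f x = g x" "Ck_on k U f"
  shows "Ck_on k U g"
  using assms(2,3)
proof (induction k arbitrary: f g)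
  case 0
  then show ?case by (simp cong: continuous_on_cong)
next
  case (Suc k)
  have *: "f differentiable (at x)" if "x \<in> U" for x using Suc.prems that by simp
  have "g differentiable (at x)" if "x \<in> U" for x
  proof -
    have "(f has_derivative frechet_derivative f (at x)) (at x)"
      using *[OF that] by (simp add: frechet_derivative_works)
    from has_derivative_transform_within_open[OF this \<open>open U\<close> that] Suc.prems(1)
    show ?thesis unfolding differentiable_def by blast
  qed
  moreover have "Ck_on k U (\<lambda>x. frechet_derivative g (at x) v)" for v
  proof (rule Suc.IH)
    show "frechet_derivative f (at x) v = frechet_derivative g (at x) v" if "x \<in> U" for x
      using frechet_derivative_cong_open[OF \<open>open U\<close> that Suc.prems(1) *[OF that]] by simp
    show "Ck_on k U (\<lambda>x. frechet_derivative f (at x) v)" using Suc.prems by simp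
  qed
  ultimately show ?case by simp
qed

lemma Ck_on_subset: "Ck_on k U f \<Longrightarrow> W \<subseteq> U \<Longrightarrow> Ck_on k W f"
  by (induction k arbitrary: f) (auto intro: continuous_on_subset)

lemma Ck_on_SucD: "Ck_on (Suc k) U f \<Longrightarrow> Ck_on k U f"
proof (induction k arbitrary: f)
  case 0
  then show ?case
    by (auto intro!: continuous_at_imp_continuous_on differentiable_imp_continuous_within)
next
  case (Suc k)
  then show ?case by (metis Ck_on.simps(2))
qed

lemma Ck_on_add:
  assumes U: "open U" shows "Ck_on k U f \<Longrightarrow> Ck_on k U g \<Longrightarrow> Ck_on k U (\<lambda>x. f x + g x)"
proof (induction k arbitrary: f g)
  case 0
  then show ?case by (auto intro: continuous_on_add)
next
  case (Suc k)
  show ?case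
    unfolding Ck_on.simps
  proof (intro conjI ballI allI)
    fix v
    have "Ck_on k U (\<lambda>x. frechet_derivative f (at x) v + frechet_derivative g (at x) v)"
      using Suc by simp
    then show "Ck_on k U (\<lambda>x. frechet_derivative (\<lambda>x. f x + g x) (at x) v)"
    proof (rule Ck_on_cong[OF U, rotated])
      fix x assume "x \<in> U"
      then show "frechet_derivative f (at x) v + frechet_derivative g (at x) v =
          frechet_derivative (\<lambda>x. f x + g x) (at x) v"
        using Suc.prems
        by (subst frechet_eqI[OF has_derivative_add]) (auto simp: frechet_derivative_works)
    qed
  qed (use Suc.prems in auto)
qed

lemma Ck_on_const: "Ck_on k U (\<lambda>x. c)"
  by (induction k arbitrary: c) auto

lemma Ck_on_sum:
  assumes "open U" "\<And>i. i \<in> I \<Longrightarrow> Ck_on k U (f i)"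
  shows "Ck_on k U (\<lambda>x. \<Sum>i\<in>I. f i x)"
  using assms(2) by (induction I rule: infinite_finite_induct) (auto intro: Ck_on_const Ck_on_add assms(1))

lemma Ck_on_linear:
  assumes "bounded_linear L" shows "Ck_on k U L"
proof (cases k)
  case 0
  then show ?thesis using assms by (simp add: linear_continuous_on)
next
  case (Suc n)
  have "frechet_derivative L (at x) = L" for x
    using assms bounded_linear_imp_has_derivative frechet_eqI by blast
  then show ?thesis
    using Suc assms by (auto simp: Ck_on_const bounded_linear_imp_differentiable)
qed

lemma Ck_on_bilinear:
  assumes U: "open U" and B: "bounded_bilinear B"
  shows "Ck_on k U f \<Longrightarrow> Ck_on k U g \<Longrightarrow> Ck_on k U (\<lambda>x. B (f x) (g x))"
proof (induction k arbitrary: f g)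
  case 0
  then show ?case by (auto intro: bounded_bilinear.continuous_on[OF B])
next
  case (Suc k)
  have d: "((\<lambda>x. B (f x) (g x)) has_derivative
      (\<lambda>v. B (f x) (frechet_derivative g (at x) v) + B (frechet_derivative f (at x) v) (g x))) (at x)"
    if "x \<in> U" for x
    using Suc.prems that by (intro bounded_bilinear.FDERIV[OF B]) (auto simp: frechet_derivative_works)
  show ?case
    unfolding Ck_on.simps
  proof (intro conjI ballI allI)
    fix v
    have "Ck_on k U f" "Ck_on k U g" using Suc.prems Ck_on_SucD by blast+
    then have "Ck_on k U (\<lambda>x. B (f x) (frechet_derivative g (at x) v) + B (frechet_derivative f (at x) v) (g x))"
      using Suc by (intro Ck_on_add U Suc.IH) auto
    then show "Ck_on k U (\<lambda>x. frechet_derivative (\<lambda>x. B (f x) (g x)) (at x) v)"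
      by (rule Ck_on_cong[OF U, rotated]) (simp add: frechet_eqI[OF d])
  qed (use d in \<open>auto simp: differentiable_def\<close>)
qed

lemma linear_Basis_sum:
  assumes "linear L" shows "L v = (\<Sum>b\<in>Basis. (v \<bullet> b) *\<^sub>R L (b::'a::euclidean_space))"
proof -
  have "L v = L (\<Sum>b\<in>Basis. (v \<bullet> b) *\<^sub>R b)" by (simp add: euclidean_representation)
  then show ?thesis by (simp add: linear_sum[OF assms] linear_cmul[OF assms])
qed

text \<open>The chain rule expresses a directional derivative of the composition as a finite sum over the basis
  of products of a component of the derivative of the inner map with a basis-directional derivative
  of the outer one; by induction all these factors have one order of smoothness less.\<close>

lemma Ck_on_compose:
  fixes f :: "'b::euclidean_space \<Rightarrow> 'c::real_normed_vector" and g :: "'a::euclidean_space \<Rightarrow> 'b"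
  assumes U: "open U" and gU: "g ` U \<subseteq> V"
  shows "Ck_on k V f \<Longrightarrow> Ck_on k U g \<Longrightarrow> Ck_on k U (\<lambda>x. f (g x))"
proof (induction k arbitrary: f)
  case 0
  then show ?case using gU continuous_on_compose2 by fastforce
next
  case (Suc k)
  have d: "((\<lambda>x. f (g x)) has_derivative
      (\<lambda>v. frechet_derivative f (at (g x)) (frechet_derivative g (at x) v))) (at x)"
    if "x \<in> U" for x
    using Suc.prems that gU
    by (intro has_derivative_compose[of g _ x UNIV f]) (auto simp: frechet_derivative_works[symmetric])
  show ?case
    unfolding Ck_on.simps
  proof (intro conjI ballI allI)
    fix v
    have "Ck_on k U g" using Suc.prems Ck_on_SucD by blast
    then have "Ck_on k U (\<lambda>x. \<Sum>b\<in>Basis. (frechet_derivative g (at x) v \<bullet> b) *\<^sub>R frechet_derivative f (at (g x)) b)"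
      using Suc
      by (intro Ck_on_sum U Ck_on_bilinear[OF U bounded_bilinear_scaleR]
         Ck_on_bilinear[OF U bounded_bilinear_inner] Suc.IH Ck_on_const) auto
    then show "Ck_on k U (\<lambda>x. frechet_derivative (\<lambda>x. f (g x)) (at x) v)"
    proof (rule Ck_on_cong[OF U, rotated])
      fix x assume x: "x \<in> U"
      have "linear (frechet_derivative f (at (g x)))"
        using Suc.prems x gU by (intro linear_frechet_derivative) auto
      note L = linear_Basis_sum[OF this, of "frechet_derivative g (at x) v"]
      show "(\<Sum>b\<in>Basis. (frechet_derivative g (at x) v \<bullet> b) *\<^sub>R frechet_derivative f (at (g x)) b)
         = frechet_derivative (\<lambda>x. f (g x)) (at x) v"
        unfolding frechet_eqI[OF d[OF x]] by (rule L[symmetric])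
    qed
  qed (use d in \<open>auto simp: differentiable_def\<close>)
qed

lemma smooth_on_open: "smooth_on U f \<Longrightarrow> open U"
  by (simp add: smooth_on_def)

lemma smooth_on_cong: "smooth_on U f \<Longrightarrow> (\<And>x. x \<in> U \<Longrightarrow> f x = g x) \<Longrightarrow> smooth_on U g"
  unfolding smooth_on_def using Ck_on_cong by blast

lemma smooth_on_subset: "smooth_on U f \<Longrightarrow> open W \<Longrightarrow> W \<subseteq> U \<Longrightarrow> smooth_on W f"
  unfolding smooth_on_def using Ck_on_subset by blast

lemma smooth_on_add: "smooth_on U f \<Longrightarrow> smooth_on U g \<Longrightarrow> smooth_on U (\<lambda>x. f x + g x)"
  unfolding smooth_on_def using Ck_on_add by blast

lemma smooth_on_sum:
  "open U \<Longrightarrow> (\<And>i. i \<in> I \<Longrightarrow> smooth_on U (f i)) \<Longrightarrow> smooth_on U (\<lambda>x. \<Sum>i\<in>I. f i x)"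
  unfolding smooth_on_def using Ck_on_sum[of U I _ f] by auto

lemma smooth_on_const: "open U \<Longrightarrow> smooth_on U (\<lambda>x. c)"
  unfolding smooth_on_def using Ck_on_const by blast

lemma smooth_on_linear: "open U \<Longrightarrow> bounded_linear L \<Longrightarrow> smooth_on U L"
  unfolding smooth_on_def using Ck_on_linear by blast

lemma smooth_on_bilinear:
  "bounded_bilinear B \<Longrightarrow> smooth_on U f \<Longrightarrow> smooth_on U g \<Longrightarrow> smooth_on U (\<lambda>x. B (f x) (g x))"
  unfolding smooth_on_def using Ck_on_bilinear by blast

lemmas smooth_on_mult = smooth_on_bilinear[OF bounded_bilinear_mult]
lemmas smooth_on_scaleR = smooth_on_bilinear[OF bounded_bilinear_scaleR]

lemma smooth_on_compose:
  fixes f :: "'b::euclidean_space \<Rightarrow> 'c::real_normed_vector" and g :: "'a::euclidean_space \<Rightarrow> 'b"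
  shows "smooth_on V f \<Longrightarrow> smooth_on U g \<Longrightarrow> g ` U \<subseteq> V \<Longrightarrow> smooth_on U (\<lambda>x. f (g x))"
  unfolding smooth_on_def using Ck_on_compose by blast

lemma smooth_on_compose_linear:
  fixes f :: "'a::euclidean_space \<Rightarrow> 'b::euclidean_space" and L :: "'b \<Rightarrow> 'c::real_normed_vector"
  shows "bounded_linear L \<Longrightarrow> smooth_on U f \<Longrightarrow> smooth_on U (\<lambda>x. L (f x))"
  by (rule smooth_on_compose[of UNIV L U f]) (auto intro: smooth_on_linear)

lemma smooth_on_differentiable: "smooth_on U f \<Longrightarrow> x \<in> U \<Longrightarrow> f differentiable (at x)"
  unfolding smooth_on_def by (metis Ck_on.simps(2))

lemma smooth_on_continuous: "smooth_on U f \<Longrightarrow> continuous_on U f"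
  unfolding smooth_on_def by (metis Ck_on.simps(1))

lemma smooth_on_derivative: "smooth_on U f \<Longrightarrow> smooth_on U (\<lambda>x. frechet_derivative f (at x) v)"
  unfolding smooth_on_def by (metis Ck_on.simps(2))

lemma smooth_on_has_derivative:
  "smooth_on U f \<Longrightarrow> x \<in> U \<Longrightarrow> (f has_derivative frechet_derivative f (at x)) (at x)"
  using smooth_on_differentiable frechet_derivative_works by blast

lemma has_real_derivative_along_line:
  assumes "(f has_derivative f') (at (x + t *\<^sub>R v))"
  shows "((\<lambda>s. f (x + s *\<^sub>R v)) has_real_derivative f' v) (at t)"
proof -
  have "((\<lambda>s. x + s *\<^sub>R v) has_derivative (\<lambda>s. s *\<^sub>R v)) (at t)"
    by (auto intro!: derivative_eq_intros)
  then have "((\<lambda>s. f (x + s *\<^sub>R v)) has_derivative (\<lambda>s. f' (s *\<^sub>R v))) (at t)"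
    by (rule has_derivative_compose) (use assms in auto)
  moreover have "f' (s *\<^sub>R v) = s * f' v" for s
    using linear_cmul[OF has_derivative_linear[OF assms]] by simp
  ultimately show ?thesis by (simp add: has_field_derivative_def mult.commute[of _ "f' v"] )
qed

text \<open>The mean value theorem is applied first in direction \<open>v\<close> to the difference of two parallel
  restrictions of the function, then in direction \<open>w\<close> to its \<open>v\<close>-derivative.\<close>

lemma second_difference_mean_value:
  fixes f :: "'a::euclidean_space \<Rightarrow> real"
  assumes f: "smooth_on U f" and h: "h > 0"
    and sub: "\<And>s t. 0 \<le> s \<Longrightarrow> s \<le> h \<Longrightarrow> 0 \<le> t \<Longrightarrow> t \<le> h \<Longrightarrow> x + s *\<^sub>R v + t *\<^sub>R w \<in> U"
  obtains s t where "0 < s" "s < h" "0 < t" "t < h"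
    "f (x + h *\<^sub>R v + h *\<^sub>R w) - f (x + h *\<^sub>R v) - f (x + h *\<^sub>R w) + f x =
      h * h * frechet_derivative (\<lambda>y. frechet_derivative f (at y) v) (at (x + s *\<^sub>R v + t *\<^sub>R w)) w"
proof -
  define f1 where "f1 = (\<lambda>y. frechet_derivative f (at y) v)"
  define g where "g = (\<lambda>s. f ((x + h *\<^sub>R w) + s *\<^sub>R v) - f (x + s *\<^sub>R v))"
  have "(g has_real_derivative f1 ((x + h *\<^sub>R w) + s *\<^sub>R v) - f1 (x + s *\<^sub>R v)) (at s)"
    if "0 \<le> s" "s \<le> h" for s
  proof -
    have "(x + h *\<^sub>R w) + s *\<^sub>R v \<in> U" "x + s *\<^sub>R v \<in> U"
      using sub[of s h] sub[of s 0] that h by (auto simp: algebra_simps)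
    then show ?thesis
      unfolding g_def f1_def
      by (intro DERIV_diff has_real_derivative_along_line smooth_on_has_derivative[OF f])
  qed
  from MVT2[OF h this] obtain s where s: "0 < s" "s < h"
    "g h - g 0 = h * (f1 ((x + h *\<^sub>R w) + s *\<^sub>R v) - f1 (x + s *\<^sub>R v))" by auto
  have "((\<lambda>t. f1 ((x + s *\<^sub>R v) + t *\<^sub>R w)) has_real_derivative
      frechet_derivative f1 (at ((x + s *\<^sub>R v) + t *\<^sub>R w)) w) (at t)" if "0 \<le> t" "t \<le> h" for t
    using sub[of s t] that s unfolding f1_def
    by (intro has_real_derivative_along_line smooth_on_has_derivative[OF smooth_on_derivative[OF f]]) auto
  from MVT2[OF h this] obtain t where t: "0 < t" "t < h"
    "f1 (x + s *\<^sub>R v + h *\<^sub>R w) - f1 (x + s *\<^sub>R v) = h * frechet_derivative f1 (at (x + s *\<^sub>R v + t *\<^sub>R w)) w"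
    by auto
  show thesis
    by (rule that[OF s(1,2) t(1,2)]) (use s(3) t(3) in \<open>simp add: g_def f1_def algebra_simps\<close>)
qed

text \<open>The second difference is symmetric in the two directions. By the mean value form it is \<open>h\<^sup>2\<close> times
  either of the mixed derivatives, taken at two points that tend to \<open>x\<close> with \<open>h\<close>; if the mixed derivatives
  differed at \<open>x\<close>, continuity would separate their values near \<open>x\<close>.\<close>

lemma smooth_on_second_derivative_symmetric:
  fixes f :: "'a::euclidean_space \<Rightarrow> real"
  assumes f: "smooth_on U f" and x: "x \<in> U"
  shows "frechet_derivative (\<lambda>y. frechet_derivative f (at y) v) (at x) w =
         frechet_derivative (\<lambda>y. frechet_derivative f (at y) w) (at x) v" (is "?a = ?b")
proof (rule ccontr)
  assume ne: "?a \<noteq> ?b"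
  define A where "A = (\<lambda>z. frechet_derivative (\<lambda>y. frechet_derivative f (at y) v) (at z) w)"
  define B where "B = (\<lambda>z. frechet_derivative (\<lambda>y. frechet_derivative f (at y) w) (at z) v)"
  define e where "e = \<bar>A x - B x\<bar> / 2"
  have e: "e > 0" using ne by (simp add: e_def A_def B_def)
  have U: "open U" using f by (rule smooth_on_open)
  have "continuous_on U A" "continuous_on U B"
    unfolding A_def B_def by (intro smooth_on_continuous smooth_on_derivative f)+
  then have "isCont A x" "isCont B x" using U x by (auto simp: continuous_on_eq_continuous_at)
  then obtain d1 d2 where d: "d1 > 0" "d2 > 0" "\<And>z. dist z x < d1 \<Longrightarrow> \<bar>A z - A x\<bar> < e"
    "\<And>z. dist z x < d2 \<Longrightarrow> \<bar>B z - B x\<bar> < e"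
    using e unfolding continuous_at_eps_delta by (auto simp: dist_real_def) metis
  obtain d3 where d3: "d3 > 0" "ball x d3 \<subseteq> U" using U x openE by blast
  define m where "m = min d1 (min d2 d3)"
  define h where "h = m / (norm v + norm w + 1)"
  have m: "m > 0" using d d3 by (simp add: m_def)
  have n: "norm v + norm w + 1 > 0" by (simp add: add_nonneg_pos)
  then have h: "h > 0" using m by (simp add: h_def)
  have small: "dist (x + s *\<^sub>R v + t *\<^sub>R w) x < m" if "0 \<le> s" "s \<le> h" "0 \<le> t" "t \<le> h" for s t
  proof -
    have "norm (s *\<^sub>R v + t *\<^sub>R w) \<le> s * norm v + t * norm w"
      using norm_triangle_ineq[of "s *\<^sub>R v" "t *\<^sub>R w"] that by simp
    also have "\<dots> \<le> h * norm v + h * norm w" using that by (intro add_mono mult_right_mono) auto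
    also have "\<dots> < h * (norm v + norm w + 1)" using h by (simp add: algebra_simps)
    also have "\<dots> = m" using n by (simp add: h_def)
    finally show ?thesis by (simp add: dist_norm add.assoc)
  qed
  have sub: "x + s *\<^sub>R v + t *\<^sub>R w \<in> U" "x + s *\<^sub>R w + t *\<^sub>R v \<in> U"
    if "0 \<le> s" "s \<le> h" "0 \<le> t" "t \<le> h" for s t
  proof -
    have "dist (x + s *\<^sub>R v + t *\<^sub>R w) x < d3" "dist (x + t *\<^sub>R v + s *\<^sub>R w) x < d3"
      using small[of s t] small[of t s] that by (auto simp: m_def)
    then show "x + s *\<^sub>R v + t *\<^sub>R w \<in> U" "x + s *\<^sub>R w + t *\<^sub>R v \<in> U"
      using d3(2) by (auto simp: dist_commute subset_iff algebra_simps)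
  qed
  obtain s t where st: "0 < s" "s < h" "0 < t" "t < h"
    "f (x + h *\<^sub>R v + h *\<^sub>R w) - f (x + h *\<^sub>R v) - f (x + h *\<^sub>R w) + f x = h * h * A (x + s *\<^sub>R v + t *\<^sub>R w)"
    using second_difference_mean_value[OF f h sub(1)] unfolding A_def by blast
  obtain s' t' where st': "0 < s'" "s' < h" "0 < t'" "t' < h"
    "f (x + h *\<^sub>R w + h *\<^sub>R v) - f (x + h *\<^sub>R w) - f (x + h *\<^sub>R v) + f x = h * h * B (x + s' *\<^sub>R w + t' *\<^sub>R v)"
    using second_difference_mean_value[OF f h sub(2)] unfolding B_def by blast
  have "h * h * A (x + s *\<^sub>R v + t *\<^sub>R w) = h * h * B (x + s' *\<^sub>R w + t' *\<^sub>R v)"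
    using st(5) st'(5) by (simp add: algebra_simps)
  then have AB: "A (x + s *\<^sub>R v + t *\<^sub>R w) = B (x + t' *\<^sub>R v + s' *\<^sub>R w)"
    using h by (simp add: algebra_simps)
  have "\<bar>A (x + s *\<^sub>R v + t *\<^sub>R w) - A x\<bar> < e" "\<bar>B (x + t' *\<^sub>R v + s' *\<^sub>R w) - B x\<bar> < e"
    using d small[of s t] small[of t' s'] st st' by (auto simp: m_def)
  then show False using AB unfolding e_def by (auto simp: abs_if split: if_splits)
qed

section \<open>Charts, derivations and Lie brackets\<close>

text \<open>Neighbourhoods are expressed through charts, because the slit tangent bundle is known by its atlas
  alone: its points are pairs with an operator, and their type is not given the topology of the bundle.\<close>

definition near :: "('a, 'e::euclidean_space) chart set \<Rightarrow> 'a \<Rightarrow> ('a \<Rightarrow> bool) \<Rightarrow> bool" where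
  "near A p P \<longleftrightarrow> (\<exists>c\<in>A. p \<in> fst c \<and> (\<exists>W. open W \<and> snd c p \<in> W \<and> W \<subseteq> snd c ` fst c \<and>
     (\<forall>q\<in>fst c. snd c q \<in> W \<longrightarrow> P q)))"

text \<open>The properties of tangent vectors on which the computations with brackets rest. Unlike membership in
  the tangent space, they pass to linear combinations without a choice of chart. The first clause
  repeats the convention that tangent vectors vanish on functions that are not smooth at the point, and the third one is locality.\<close>

definition derivation :: "('a, 'e::euclidean_space) chart set \<Rightarrow> 'a \<Rightarrow> 'a tvector \<Rightarrow> bool" where
  "derivation A p v \<longleftrightarrow>
     (\<forall>f. \<not> smooth_near A f p \<longrightarrow> v f = 0) \<and> (\<forall>a. v (\<lambda>_. a) = 0) \<and>
     (\<forall>f g. smooth_near A f p \<longrightarrow> near A p (\<lambda>q. f q = g q) \<longrightarrow> v f = v g) \<and>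
     (\<forall>f g. smooth_near A f p \<longrightarrow> smooth_near A g p \<longrightarrow>
        v (\<lambda>q. f q + g q) = v f + v g \<and> v (\<lambda>q. f q * g q) = f p * v g + v f * g p)"

definition derivation_field :: "('a, 'e::euclidean_space) chart set \<Rightarrow> 'a vfield \<Rightarrow> bool" where
  "derivation_field A X \<longleftrightarrow> (\<forall>p. derivation A p (X p)) \<and>
     (\<forall>f p. smooth_near A f p \<longrightarrow> smooth_near A (vapply X f) p)"

lemma smooth_funD: "smooth_fun A f \<Longrightarrow> p \<in> carrier A \<Longrightarrow> smooth_near A f p"
  by (simp add: smooth_fun_def)

text \<open>The common ground of the base surface and its slit tangent bundle: injective charts with open
  images and smooth transition maps.\<close>

locale chart_system =
  fixes A :: "('a, 'e::euclidean_space) chart set"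
  assumes inj_chart: "c \<in> A \<Longrightarrow> inj_on (snd c) (fst c)"
    and open_image: "c \<in> A \<Longrightarrow> open (snd c ` fst c)"
    and smooth_transition: "c \<in> A \<Longrightarrow> d \<in> A \<Longrightarrow> smooth_on (snd c ` (fst c \<inter> fst d)) (snd d \<circ> chart_inv c)"
begin

lemma chart_inv [simp]: "c \<in> A \<Longrightarrow> p \<in> fst c \<Longrightarrow> chart_inv c (snd c p) = p"
  by (simp add: chart_inv_def inj_chart)

lemma nearI:
  assumes "c \<in> A" "p \<in> fst c" "open W" "snd c p \<in> W" "W \<subseteq> snd c ` fst c"
    "\<And>q. q \<in> fst c \<Longrightarrow> snd c q \<in> W \<Longrightarrow> P q"
  shows "near A p P"
  using assms unfolding near_def by blast

text \<open>Transition maps are continuous on open sets, so neighbourhoods can be moved from one chart to another.\<close>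

lemma near_in_chart:
  assumes "near A p P" and c: "c \<in> A" "p \<in> fst c"
  obtains W where "open W" "snd c p \<in> W" "W \<subseteq> snd c ` fst c" "\<forall>q\<in>fst c. snd c q \<in> W \<longrightarrow> P q"
proof -
  obtain d W' where d: "d \<in> A" "p \<in> fst d" and W': "open W'" "snd d p \<in> W'"
    "\<And>q. q \<in> fst d \<Longrightarrow> snd d q \<in> W' \<Longrightarrow> P q"
    using assms(1) unfolding near_def by blast
  define U where "U = snd c ` (fst c \<inter> fst d)"
  define \<tau> where "\<tau> = snd d \<circ> chart_inv c"
  have "smooth_on U \<tau>" using smooth_transition[OF c(1) d(1)] by (simp add: U_def \<tau>_def)
  then have "open U" "continuous_on U \<tau>" by (simp_all add: smooth_on_open smooth_on_continuous)
  then have "open (U \<inter> \<tau> -` W')" using W'(1) continuous_open_preimage by blast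
  moreover have "snd c p \<in> U \<inter> \<tau> -` W'" using c d W' by (auto simp: U_def \<tau>_def)
  moreover have "P q" if q: "q \<in> fst c" "snd c q \<in> U \<inter> \<tau> -` W'" for q
  proof -
    have "q \<in> fst d" using q inj_onD[OF inj_chart[OF c(1)]] by (auto simp: U_def)
    then show ?thesis using q W'(3) c by (auto simp: \<tau>_def)
  qed
  ultimately show thesis by (intro that[of "U \<inter> \<tau> -` W'"]) (auto simp: U_def)
qed

lemma near_mono: "near A p P \<Longrightarrow> (\<And>q. P q \<Longrightarrow> Q q) \<Longrightarrow> near A p Q"
  unfolding near_def by meson

lemma near_chart: "c \<in> A \<Longrightarrow> p \<in> fst c \<Longrightarrow> near A p (\<lambda>q. q \<in> fst c)"
  by (rule nearI[OF _ _ open_image]) auto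

text \<open>Smoothness is defined with some chart; smooth transition maps give it in every chart.\<close>

lemma smooth_near_in_chart:
  assumes "smooth_near A f p" and c: "c \<in> A" "p \<in> fst c"
  obtains W where "snd c p \<in> W" "W \<subseteq> snd c ` fst c" "smooth_on W (f \<circ> chart_inv c)"
proof -
  obtain d W' where d: "d \<in> A" "p \<in> fst d" and W': "snd d p \<in> W'" "W' \<subseteq> snd d ` fst d"
    "smooth_on W' (f \<circ> chart_inv d)"
    using assms(1) unfolding smooth_near_def by blast
  have n: "near A p (\<lambda>q. q \<in> fst d \<and> snd d q \<in> W')"
    by (rule nearI[OF d smooth_on_open[OF W'(3)] W'(1,2)]) simp
  obtain W where W: "open W" "snd c p \<in> W" "W \<subseteq> snd c ` fst c"
    "\<forall>q\<in>fst c. snd c q \<in> W \<longrightarrow> q \<in> fst d \<and> snd d q \<in> W'"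
    using near_in_chart[OF n c] .
  have "smooth_on W (snd d \<circ> chart_inv c)"
    by (rule smooth_on_subset[OF smooth_transition[OF c(1) d(1)]]) (use W in blast)+
  then have "smooth_on W (\<lambda>x. (f \<circ> chart_inv d) ((snd d \<circ> chart_inv c) x))"
    by (rule smooth_on_compose[OF W'(3)]) (use W c in auto)
  then have "smooth_on W (f \<circ> chart_inv c)"
    by (rule smooth_on_cong) (use W c d in auto)
  with W show thesis using that by blast
qed

lemma smooth_near_near: "smooth_near A f p \<Longrightarrow> near A p (smooth_near A f)"
  unfolding smooth_near_def by (elim bexE conjE exE, rule nearI) (auto dest: smooth_on_open)

lemma smooth_near_cong:
  assumes f: "smooth_near A f p" and fg: "near A p (\<lambda>q. f q = g q)"
  shows "smooth_near A g p"
proof -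
  obtain c where c: "c \<in> A" "p \<in> fst c" using f unfolding smooth_near_def by blast
  obtain W where W: "snd c p \<in> W" "W \<subseteq> snd c ` fst c" "smooth_on W (f \<circ> chart_inv c)"
    using smooth_near_in_chart[OF f c] .
  obtain W' where W': "open W'" "snd c p \<in> W'" "\<forall>q\<in>fst c. snd c q \<in> W' \<longrightarrow> f q = g q"
    using near_in_chart[OF fg c] by metis
  have "smooth_on (W \<inter> W') (f \<circ> chart_inv c)"
    by (rule smooth_on_subset[OF W(3) open_Int[OF smooth_on_open[OF W(3)] W'(1)]]) simp
  then have "smooth_on (W \<inter> W') (g \<circ> chart_inv c)"
    by (rule smooth_on_cong) (use W W' c in auto)
  then show ?thesis unfolding smooth_near_def using c W W' by blast
qed

lemma smooth_near_common_chart: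
  assumes "smooth_near A f p" "smooth_near A g p" and c: "c \<in> A" "p \<in> fst c"
  obtains W where "snd c p \<in> W" "W \<subseteq> snd c ` fst c"
    "smooth_on W (f \<circ> chart_inv c)" "smooth_on W (g \<circ> chart_inv c)"
proof -
  obtain W where W: "snd c p \<in> W" "W \<subseteq> snd c ` fst c" "smooth_on W (f \<circ> chart_inv c)"
    using smooth_near_in_chart[OF assms(1) c] .
  obtain W' where W': "snd c p \<in> W'" "W' \<subseteq> snd c ` fst c" "smooth_on W' (g \<circ> chart_inv c)"
    using smooth_near_in_chart[OF assms(2) c] .
  note o = open_Int[OF smooth_on_open[OF W(3)] smooth_on_open[OF W'(3)]]
  show thesis
    by (rule that[of "W \<inter> W'"])
      (use W W' smooth_on_subset[OF W(3) o] smooth_on_subset[OF W'(3) o] in auto)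
qed

lemma smooth_near_carrier: "smooth_near A f p \<Longrightarrow> p \<in> carrier A"
  unfolding smooth_near_def carrier_def by blast

lemma carrier_chart: "p \<in> carrier A \<Longrightarrow> \<exists>c\<in>A. p \<in> fst c"
  by (simp add: carrier_def)

lemma smooth_near_const: "p \<in> carrier A \<Longrightarrow> smooth_near A (\<lambda>_. a) p"
  unfolding smooth_near_def carrier_def o_def
  using open_image smooth_on_const by blast

lemma smooth_near_add: "smooth_near A f p \<Longrightarrow> smooth_near A g p \<Longrightarrow> smooth_near A (\<lambda>q. f q + g q) p"
  and smooth_near_mult: "smooth_near A f p \<Longrightarrow> smooth_near A g p \<Longrightarrow> smooth_near A (\<lambda>q. f q * g q) p"
proof -
  assume f: "smooth_near A f p" and g: "smooth_near A g p"
  obtain c where c: "c \<in> A" "p \<in> fst c" using f unfolding smooth_near_def by blast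
  obtain W where W: "snd c p \<in> W" "W \<subseteq> snd c ` fst c"
    "smooth_on W (f \<circ> chart_inv c)" "smooth_on W (g \<circ> chart_inv c)"
    using smooth_near_common_chart[OF f g c] .
  show "smooth_near A (\<lambda>q. f q + g q) p" "smooth_near A (\<lambda>q. f q * g q) p"
    unfolding smooth_near_def
    using c W smooth_on_add[OF W(3,4)] smooth_on_mult[OF W(3,4)] by (auto simp: o_def)
qed

lemma smooth_near_uminus: "smooth_near A f p \<Longrightarrow> smooth_near A (\<lambda>q. - f q) p"
  using smooth_near_mult[OF smooth_near_const[of p "-1"], of f] smooth_near_carrier[of f p] by simp

lemma smooth_near_diff: "smooth_near A f p \<Longrightarrow> smooth_near A g p \<Longrightarrow> smooth_near A (\<lambda>q. f q - g q) p"
  using smooth_near_add[OF _ smooth_near_uminus, of f p g] by simp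

lemma smooth_near_linear_coord:
  assumes "bounded_linear L" "c \<in> A" "p \<in> fst c"
  shows "smooth_near A (\<lambda>q. L (snd c q)) p"
proof -
  have "smooth_on (snd c ` fst c) ((\<lambda>q. L (snd c q)) \<circ> chart_inv c)"
    by (rule smooth_on_cong[OF smooth_on_linear[OF open_image assms(1)]]) (use assms in auto)
  then show ?thesis unfolding smooth_near_def using assms by blast
qed

lemma coord_vec_smooth:
  "p \<in> fst c \<Longrightarrow> smooth_near A f p \<Longrightarrow>
    coord_vec A c e p f = frechet_derivative (f \<circ> chart_inv c) (at (snd c p)) e"
  by (simp add: coord_vec_def)

lemma coord_vec_linear_coord:
  assumes L: "bounded_linear L" and c: "c \<in> A" "p \<in> fst c"
  shows "coord_vec A c e p (\<lambda>q. L (snd c q)) = L e"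
proof -
  have "frechet_derivative L (at (snd c p)) = frechet_derivative ((\<lambda>q. L (snd c q)) \<circ> chart_inv c) (at (snd c p))"
    by (rule frechet_derivative_cong_open[OF open_image])
      (use c L in \<open>auto intro: bounded_linear_imp_differentiable\<close>)
  moreover have "frechet_derivative L (at (snd c p)) = L"
    using L bounded_linear_imp_has_derivative frechet_eqI by blast
  ultimately show ?thesis
    using c by (simp add: coord_vec_smooth smooth_near_linear_coord[OF L])
qed

lemma chain_rule:
  assumes f: "smooth_near A f p" and c: "c \<in> A" "p \<in> fst c" and d: "d \<in> A" "p \<in> fst d"
  shows "frechet_derivative (f \<circ> chart_inv d) (at (snd d p)) e =
    frechet_derivative (f \<circ> chart_inv c) (at (snd c p))
      (frechet_derivative (snd c \<circ> chart_inv d) (at (snd d p)) e)"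
proof -
  define U where "U = snd d ` (fst d \<inter> fst c)"
  have \<tau>: "smooth_on U (snd c \<circ> chart_inv d)"
    using smooth_transition[OF d(1) c(1)] by (simp add: U_def)
  have pU: "snd d p \<in> U" using c d by (simp add: U_def)
  obtain W where W: "snd c p \<in> W" "smooth_on W (f \<circ> chart_inv c)"
    using smooth_near_in_chart[OF f c] by metis
  have eq: "(snd c \<circ> chart_inv d) (snd d p) = snd c p" using d by simp
  have "((\<lambda>x. (f \<circ> chart_inv c) ((snd c \<circ> chart_inv d) x)) has_derivative
      (\<lambda>e. frechet_derivative (f \<circ> chart_inv c) (at (snd c p))
        (frechet_derivative (snd c \<circ> chart_inv d) (at (snd d p)) e))) (at (snd d p))"
    by (rule has_derivative_compose[OF smooth_on_has_derivative[OF \<tau> pU]])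
      (unfold eq, rule smooth_on_has_derivative[OF W(2,1)])
  moreover have "(f \<circ> chart_inv c) ((snd c \<circ> chart_inv d) x) = (f \<circ> chart_inv d) x" if "x \<in> U" for x
    using that c d by (auto simp: U_def)
  ultimately have "((f \<circ> chart_inv d) has_derivative
      (\<lambda>e. frechet_derivative (f \<circ> chart_inv c) (at (snd c p))
        (frechet_derivative (snd c \<circ> chart_inv d) (at (snd d p)) e))) (at (snd d p))"
    using has_derivative_transform_within_open smooth_on_open[OF \<tau>] pU by blast
  then show ?thesis by (simp add: frechet_eqI)
qed

lemma coord_vec_change_chart:
  assumes "c \<in> A" "p \<in> fst c" "d \<in> A" "p \<in> fst d"
  shows "coord_vec A d e p = coord_vec A c (frechet_derivative (snd c \<circ> chart_inv d) (at (snd d p)) e) p"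
  using assms chain_rule[OF _ assms] by (fastforce simp: coord_vec_def)

lemma tangent_space_chart:
  assumes "c \<in> A" "p \<in> fst c"
  shows "tangent_space A p = range (\<lambda>e. coord_vec A c e p)"
  using assms coord_vec_change_chart[OF assms] unfolding tangent_space_def by blast

lemma linear_coord_vec:
  assumes "c \<in> A" "p \<in> fst c" shows "linear (\<lambda>e. coord_vec A c e p f)"
proof (cases "smooth_near A f p")
  case True
  obtain W where "snd c p \<in> W" "smooth_on W (f \<circ> chart_inv c)"
    using smooth_near_in_chart[OF True assms] by metis
  then have "linear (frechet_derivative (f \<circ> chart_inv c) (at (snd c p)))"
    using smooth_on_differentiable linear_frechet_derivative by blast
  then show ?thesis using True assms by (simp add: coord_vec_def)
next
  case False
  then show ?thesis by (simp add: coord_vec_def linear_iff)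
qed

lemma tangent_space_combination:
  assumes p: "p \<in> carrier A" and vw: "v \<in> tangent_space A p" "w \<in> tangent_space A p"
  shows "(\<lambda>f. a * v f + b * w f) \<in> tangent_space A p"
proof -
  obtain c where c: "c \<in> A" "p \<in> fst c" using p carrier_chart by blast
  obtain e e' where "v = coord_vec A c e p" "w = coord_vec A c e' p"
    using vw unfolding tangent_space_chart[OF c] by blast
  then have "(\<lambda>f. a * v f + b * w f) = coord_vec A c (a *\<^sub>R e + b *\<^sub>R e') p"
    by (simp add: fun_eq_iff linear_add[OF linear_coord_vec[OF c]] linear_cmul[OF linear_coord_vec[OF c]])
  then show ?thesis unfolding tangent_space_chart[OF c] by blast
qed

text \<open>In a chart these are the usual rules for the Frechet derivative.\<close>

lemma derivation_coord_vec:
  assumes c: "c \<in> A" "p \<in> fst c"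
  shows "derivation A p (coord_vec A c e p)"
  unfolding derivation_def
proof (intro conjI allI impI)
  fix f assume "\<not> smooth_near A f p" then show "coord_vec A c e p f = 0" by (simp add: coord_vec_def)
next
  fix a show "coord_vec A c e p (\<lambda>_. a) = 0" by (simp add: coord_vec_def o_def)
next
  fix f g assume f: "smooth_near A f p" and fg: "near A p (\<lambda>q. f q = g q)"
  obtain W where W: "snd c p \<in> W" "smooth_on W (f \<circ> chart_inv c)"
    using smooth_near_in_chart[OF f c] by metis
  obtain W' where W': "open W'" "snd c p \<in> W'" "W' \<subseteq> snd c ` fst c"
     "\<forall>q\<in>fst c. snd c q \<in> W' \<longrightarrow> f q = g q"
    using near_in_chart[OF fg c] by metis
  have "frechet_derivative (f \<circ> chart_inv c) (at (snd c p)) = frechet_derivative (g \<circ> chart_inv c) (at (snd c p))"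
    by (rule frechet_derivative_cong_open[OF W'(1,2)]) (use W W' c smooth_on_differentiable in auto)
  then show "coord_vec A c e p f = coord_vec A c e p g"
    using f smooth_near_cong[OF f fg] c by (simp add: coord_vec_def)
next
  fix f g assume f: "smooth_near A f p" and g: "smooth_near A g p"
  obtain W where W: "snd c p \<in> W" "smooth_on W (f \<circ> chart_inv c)" "smooth_on W (g \<circ> chart_inv c)"
    using smooth_near_common_chart[OF f g c] by metis
  note df = smooth_on_has_derivative[OF W(2,1)] and dg = smooth_on_has_derivative[OF W(3,1)]
  show "coord_vec A c e p (\<lambda>q. f q + g q) = coord_vec A c e p f + coord_vec A c e p g"
    using frechet_eqI[OF has_derivative_add[OF df dg]] smooth_near_add[OF f g] f g c
    by (simp add: coord_vec_def o_def)
  show "coord_vec A c e p (\<lambda>q. f q * g q) = f p * coord_vec A c e p g + coord_vec A c e p f * g p"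
    using frechet_eqI[OF has_derivative_mult[OF df dg]] smooth_near_mult[OF f g] f g c
    by (simp add: coord_vec_def o_def)
qed

lemma derivation_tangent: "p \<in> carrier A \<Longrightarrow> v \<in> tangent_space A p \<Longrightarrow> derivation A p v"
  by (metis carrier_chart derivation_coord_vec tangent_space_chart rangeE)

lemma derivation_outside: "p \<notin> carrier A \<Longrightarrow> derivation A p 0"
  unfolding derivation_def by auto

lemma vector_field_derivation_field: "vector_field A X \<Longrightarrow> derivation_field A X"
  unfolding vector_field_def derivation_field_def vapply_def
  by (metis derivation_tangent derivation_outside)

lemma derivation_add:
  "derivation A p v \<Longrightarrow> smooth_near A f p \<Longrightarrow> smooth_near A g p \<Longrightarrow> v (\<lambda>q. f q + g q) = v f + v g"
  unfolding derivation_def by blast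

lemma derivation_mult:
  "derivation A p v \<Longrightarrow> smooth_near A f p \<Longrightarrow> smooth_near A g p \<Longrightarrow>
    v (\<lambda>q. f q * g q) = f p * v g + v f * g p"
  unfolding derivation_def by blast

lemma derivation_local:
  "derivation A p v \<Longrightarrow> smooth_near A f p \<Longrightarrow> near A p (\<lambda>q. f q = g q) \<Longrightarrow> v f = v g"
  unfolding derivation_def by blast

lemma derivation_const: "derivation A p v \<Longrightarrow> v (\<lambda>_. a) = 0"
  unfolding derivation_def by blast

lemma derivation_nonsmooth: "derivation A p v \<Longrightarrow> \<not> smooth_near A f p \<Longrightarrow> v f = 0"
  unfolding derivation_def by blast

lemma derivation_uminus:
  assumes "derivation A p v" "smooth_near A f p" shows "v (\<lambda>q. - f q) = - v f"
  using derivation_mult[OF assms(1) smooth_near_const[of p "-1"] assms(2)]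
    derivation_const[OF assms(1)] smooth_near_carrier[OF assms(2)] by simp

lemma derivation_diff:
  assumes "derivation A p v" "smooth_near A f p" "smooth_near A g p"
  shows "v (\<lambda>q. f q - g q) = v f - v g"
  using derivation_add[OF assms(1,2) smooth_near_uminus[OF assms(3)]] derivation_uminus[OF assms(1,3)] by simp

lemma derivation_sum:
  assumes "derivation A p v" "finite I" "\<And>i. i \<in> I \<Longrightarrow> smooth_near A (f i) p" "p \<in> carrier A"
  shows "smooth_near A (\<lambda>q. \<Sum>i\<in>I. f i q) p \<and> v (\<lambda>q. \<Sum>i\<in>I. f i q) = (\<Sum>i\<in>I. v (f i))"
  using assms(2,3)
  by (induction I) (auto simp: smooth_near_const assms derivation_const[OF assms(1)] smooth_near_add
     derivation_add[OF assms(1)])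

lemma derivation_combination:
  assumes "derivation A p v" "derivation A p w" shows "derivation A p (\<lambda>f. a * v f + b * w f)"
  using assms unfolding derivation_def by (intro conjI allI impI) (auto simp: algebra_simps)

text \<open>The coordinate functions are linear in the chart, so the vector with components \<open>e\<close> takes on them the
  values \<open>e \<bullet> b\<close>, from which it can be recovered.\<close>

lemma tangent_vector_coord:
  assumes c: "c \<in> A" "p \<in> fst c" and v: "v \<in> tangent_space A p"
  shows "v f = (\<Sum>b\<in>Basis. v (\<lambda>q. snd c q \<bullet> b) * coord_vec A c b p f)"
proof -
  obtain e where e: "v = coord_vec A c e p" using v tangent_space_chart[OF c] by blast
  have "v (\<lambda>q. snd c q \<bullet> b) = e \<bullet> b" for b
    unfolding e by (rule coord_vec_linear_coord[OF bounded_linear_inner_left c])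
  then show ?thesis
    using linear_Basis_sum[OF linear_coord_vec[OF c], of e f] by (simp add: e)
qed

lemma smooth_near_coord_vec:
  assumes f: "smooth_near A f p" and c: "c \<in> A" "p \<in> fst c"
  shows "smooth_near A (\<lambda>q. coord_vec A c e q f) p"
    and "coord_vec A c e' p (\<lambda>q. coord_vec A c e q f) =
      frechet_derivative (\<lambda>x. frechet_derivative (f \<circ> chart_inv c) (at x) e) (at (snd c p)) e'"
proof -
  obtain W where W: "snd c p \<in> W" "W \<subseteq> snd c ` fst c" "smooth_on W (f \<circ> chart_inv c)"
    using smooth_near_in_chart[OF f c] by metis
  have eq: "coord_vec A c e (chart_inv c x) f = frechet_derivative (f \<circ> chart_inv c) (at x) e"
    if x: "x \<in> W" for x
  proof -
    obtain q where q: "q \<in> fst c" "x = snd c q" using x W by blast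
    have "smooth_near A f q" unfolding smooth_near_def using c W x q by blast
    then show ?thesis using q c by (simp add: coord_vec_def)
  qed
  note sd = smooth_on_derivative[OF W(3), of e]
  have s: "smooth_on W ((\<lambda>q. coord_vec A c e q f) \<circ> chart_inv c)"
    by (rule smooth_on_cong[OF sd]) (simp add: eq)
  then show sm: "smooth_near A (\<lambda>q. coord_vec A c e q f) p"
    unfolding smooth_near_def using c W by blast
  have "frechet_derivative (\<lambda>x. frechet_derivative (f \<circ> chart_inv c) (at x) e) (at (snd c p)) =
        frechet_derivative ((\<lambda>q. coord_vec A c e q f) \<circ> chart_inv c) (at (snd c p))"
    by (rule frechet_derivative_cong_open[OF smooth_on_open[OF W(3)] W(1)])
      (auto simp: eq intro: smooth_on_differentiable[OF sd] W)
  then show "coord_vec A c e' p (\<lambda>q. coord_vec A c e q f) =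
      frechet_derivative (\<lambda>x. frechet_derivative (f \<circ> chart_inv c) (at x) e) (at (snd c p)) e'"
    using sm c by (simp add: coord_vec_smooth)
qed

text \<open>Iterated coordinate derivatives are second derivatives in the chart, hence symmetric.\<close>

lemma coord_vec_commute:
  assumes f: "smooth_near A f p" and c: "c \<in> A" "p \<in> fst c"
  shows "coord_vec A c e p (\<lambda>q. coord_vec A c e' q f) = coord_vec A c e' p (\<lambda>q. coord_vec A c e q f)"
proof -
  obtain W where W: "snd c p \<in> W" "smooth_on W (f \<circ> chart_inv c)"
    using smooth_near_in_chart[OF f c] by metis
  show ?thesis
    unfolding smooth_near_coord_vec(2)[OF f c]
    by (rule smooth_on_second_derivative_symmetric[OF W(2,1)])
qed

text \<open>Expanding \<open>X (Y f)\<close> in a chart gives a first-order part, whose coefficients are the values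
  \<open>X (Y (x\<^sup>b))\<close> on the coordinates, and a second-order part that is symmetric in \<open>X\<close> and \<open>Y\<close> and so cancels in the bracket.
  A bracket is therefore zero as soon as it vanishes on the coordinate functions.\<close>

lemma lie_in_coordinates:
  assumes X: "vector_field A X" and Y: "vector_field A Y" and c: "c \<in> A" "p \<in> fst c"
  shows "lie A X Y p f = (\<Sum>b\<in>Basis. lie A X Y p (\<lambda>q. snd c q \<bullet> b) * coord_vec A c b p f)"
proof (cases "smooth_near A f p")
  case False
  then show ?thesis by (simp add: lie_def coord_vec_def)
next
  case f: True
  have p: "p \<in> carrier A" using f by (rule smooth_near_carrier)
  let ?x = "\<lambda>b q. snd c q \<bullet> b"
  let ?d = "\<lambda>b q. coord_vec A c b q f"
  have xs: "smooth_near A (?x b) q" if "q \<in> fst c" for b q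
    by (rule smooth_near_linear_coord[OF bounded_linear_inner_left c(1) that])
  have second: "X p (vapply Y f) = (\<Sum>b\<in>Basis. X p (vapply Y (?x b)) * ?d b p) +
      (\<Sum>b\<in>Basis. \<Sum>a\<in>Basis. Y p (?x b) * X p (?x a) * coord_vec A c a p (?d b))"
    if X: "vector_field A X" and Y: "vector_field A Y" for X Y
  proof -
    have Xp: "derivation A p (X p)" "X p \<in> tangent_space A p"
      using X p derivation_tangent unfolding vector_field_def by blast+
    have sY: "smooth_near A (vapply Y g) p" if "smooth_near A g p" for g
      using Y that unfolding vector_field_def vapply_def by blast
    have "near A p (\<lambda>q. vapply Y f q = (\<Sum>b\<in>Basis. vapply Y (?x b) q * ?d b q))"
    proof (rule near_mono[OF near_chart[OF c]])
      fix q assume q: "q \<in> fst c"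
      then have "Y q \<in> tangent_space A q"
        using Y c unfolding vector_field_def carrier_def by blast
      from tangent_vector_coord[OF c(1) q this]
      show "vapply Y f q = (\<Sum>b\<in>Basis. vapply Y (?x b) q * ?d b q)"
        unfolding vapply_def .
    qed
    then have "X p (vapply Y f) = X p (\<lambda>q. \<Sum>b\<in>Basis. vapply Y (?x b) q * ?d b q)"
      by (rule derivation_local[OF Xp(1) sY[OF f]])
    also have "\<dots> = (\<Sum>b\<in>Basis. X p (\<lambda>q. vapply Y (?x b) q * ?d b q))"
      by (intro conjunct2[OF derivation_sum[OF Xp(1) finite_Basis _ p]] smooth_near_mult sY xs c
        smooth_near_coord_vec(1)[OF f c])
    also have "\<dots> = (\<Sum>b\<in>Basis. Y p (?x b) * X p (?d b) + X p (vapply Y (?x b)) * ?d b p)"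
      using derivation_mult[OF Xp(1) sY[OF xs[OF c(2)]] smooth_near_coord_vec(1)[OF f c]]
      by (simp add: vapply_def)
    also have "\<dots> = (\<Sum>b\<in>Basis. X p (vapply Y (?x b)) * ?d b p) +
        (\<Sum>b\<in>Basis. Y p (?x b) * X p (?d b))"
      by (simp add: sum.distrib)
    also have "(\<Sum>b\<in>Basis. Y p (?x b) * X p (?d b)) =
        (\<Sum>b\<in>Basis. \<Sum>a\<in>Basis. Y p (?x b) * X p (?x a) * coord_vec A c a p (?d b))"
      by (subst tangent_vector_coord[OF c Xp(2)]) (simp add: sum_distrib_left mult.assoc)
    finally show ?thesis .
  qed
  have "(\<Sum>b\<in>Basis. \<Sum>a\<in>Basis. Y p (?x b) * X p (?x a) * coord_vec A c a p (?d b)) =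
        (\<Sum>b\<in>Basis. \<Sum>a\<in>Basis. X p (?x b) * Y p (?x a) * coord_vec A c a p (?d b))"
    by (subst sum.swap) (simp add: coord_vec_commute[OF f c] mult.commute)
  then have "X p (vapply Y f) - Y p (vapply X f) =
     (\<Sum>b\<in>Basis. X p (vapply Y (?x b)) * ?d b p) - (\<Sum>b\<in>Basis. Y p (vapply X (?x b)) * ?d b p)"
    unfolding second[OF X Y] second[OF Y X] by simp
  then show ?thesis
    using f xs[OF c(2)] by (simp add: lie_def sum_subtractf left_diff_distrib)
qed

text \<open>On a smooth function all twelve third-order terms cancel in pairs. Locality is needed because the
  inner bracket is the difference of the two compositions only at the points where the function is
  smooth; these contain a neighbourhood of the given point.\<close>

lemma jacobi_identity:
  assumes "derivation_field A X" "derivation_field A Y" "derivation_field A Z"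
  shows "lie A X (lie A Y Z) = lie A (lie A X Y) Z + lie A Y (lie A X Z)"
proof (intro ext)
  fix p f
  show "lie A X (lie A Y Z) p f = (lie A (lie A X Y) Z + lie A Y (lie A X Z)) p f"
  proof (cases "smooth_near A f p")
    case False
    then show ?thesis by (simp add: lie_def)
  next
    case f: True
    have expand: "U p (vapply (lie A V W) g) = U p (vapply V (vapply W g)) - U p (vapply W (vapply V g))"
      if U: "derivation_field A U" and V: "derivation_field A V" and W: "derivation_field A W"
        and g: "smooth_near A g p"
      for U V W g
    proof -
      have s: "smooth_near A (vapply V (vapply W g)) p" "smooth_near A (vapply W (vapply V g)) p"
        using V W g unfolding derivation_field_def by blast+
      have Up: "derivation A p (U p)" using U by (simp add: derivation_field_def)
      have n: "near A p (\<lambda>q. vapply V (vapply W g) q - vapply W (vapply V g) q = vapply (lie A V W) g q)"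
        by (rule near_mono[OF smooth_near_near[OF g]]) (simp add: lie_def vapply_def)
      show ?thesis
        using derivation_local[OF Up smooth_near_diff[OF s] n] derivation_diff[OF Up s] by simp
    qed
    have s: "smooth_near A (vapply U f) p" if "derivation_field A U" for U
      using that f unfolding derivation_field_def by blast
    have e: "lie A U V p g = U p (vapply V g) - V p (vapply U g)" if "smooth_near A g p" for U V g
      using that by (simp add: lie_def)
    show ?thesis
      using assms by (simp add: e f s expand)
  qed
qed

lemma zero_coord_vec_iff:
  assumes c: "c \<in> A" "p \<in> fst c" shows "coord_vec A c e p = 0 \<longleftrightarrow> e = 0"
proof
  assume "coord_vec A c e p = 0"
  then have "e \<bullet> b = 0" for b
    using coord_vec_linear_coord[OF bounded_linear_inner_left c, of e b] by simp
  then show "e = 0" using euclidean_eqI by fastforce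
next
  show "coord_vec A c e p = 0" if "e = 0"
    using linear_0[OF linear_coord_vec[OF c]] that by (simp add: fun_eq_iff)
qed

lemma smooth_fun_const: "smooth_fun A (\<lambda>_. a)"
  by (simp add: smooth_fun_def smooth_near_const)

lemma smooth_fun_add: "smooth_fun A f \<Longrightarrow> smooth_fun A g \<Longrightarrow> smooth_fun A (\<lambda>p. f p + g p)"
  by (simp add: smooth_fun_def smooth_near_add)

lemma smooth_fun_mult: "smooth_fun A f \<Longrightarrow> smooth_fun A g \<Longrightarrow> smooth_fun A (\<lambda>p. f p * g p)"
  by (simp add: smooth_fun_def smooth_near_mult)

lemma smooth_fun_uminus: "smooth_fun A f \<Longrightarrow> smooth_fun A (\<lambda>p. - f p)"
  by (simp add: smooth_fun_def smooth_near_uminus)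

lemma smooth_fun_diff: "smooth_fun A f \<Longrightarrow> smooth_fun A g \<Longrightarrow> smooth_fun A (\<lambda>p. f p - g p)"
  by (simp add: smooth_fun_def smooth_near_diff)

lemma smooth_fun_field: "derivation_field A X \<Longrightarrow> smooth_fun A f \<Longrightarrow> smooth_fun A (\<lambda>p. X p f)"
  unfolding smooth_fun_def derivation_field_def vapply_def by blast

lemma one_form_combination4:
  assumes \<eta>: "one_form A \<eta>" and p: "p \<in> carrier A"
    and t: "v1 \<in> tangent_space A p" "v2 \<in> tangent_space A p" "v3 \<in> tangent_space A p" "v4 \<in> tangent_space A p"
  shows "\<eta> p (\<lambda>f. a1 * v1 f + a2 * v2 f + a3 * v3 f + a4 * v4 f) =
    a1 * \<eta> p v1 + a2 * \<eta> p v2 + a3 * \<eta> p v3 + a4 * \<eta> p v4"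
proof -
  have lin: "\<eta> p (\<lambda>f. a * v f + b * w f) = a * \<eta> p v + b * \<eta> p w"
    if "v \<in> tangent_space A p" "w \<in> tangent_space A p" for a b v w
    using \<eta> p that unfolding one_form_def by blast
  note tc = tangent_space_combination[OF p]
  have "(\<lambda>f. a1 * v1 f + a2 * v2 f + a3 * v3 f + a4 * v4 f) =
      (\<lambda>f. 1 * (a1 * v1 f + a2 * v2 f) + 1 * (a3 * v3 f + a4 * v4 f))"
    by (simp add: fun_eq_iff)
  then show ?thesis
    using lin[OF tc[OF t(1,2)] tc[OF t(3,4)], of 1 a1 a2 1 a3 a4] lin[OF t(1,2)] lin[OF t(3,4)]
    by simp
qed

end

section \<open>The slit tangent bundle as a manifold\<close>

lemma chart_system_smooth_atlas:
  assumes "smooth_atlas A" shows "chart_system A"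
proof
  fix c d assume "c \<in> A" "d \<in> A"
  then have "homeomorphism (fst c) (snd c ` fst c) (snd c) (chart_inv c)"
    and "open (snd c ` fst c)" "smooth_on (snd c ` (fst c \<inter> fst d)) (snd d \<circ> chart_inv c)"
    using assms unfolding smooth_atlas_def by blast+
  then show "inj_on (snd c) (fst c)" "open (snd c ` fst c)"
    "smooth_on (snd c ` (fst c \<inter> fst d)) (snd d \<circ> chart_inv c)"
    by (auto simp: homeomorphism_def intro!: inj_on_inverseI[of _ "chart_inv c"])
qed

locale base_surface = chart_system A for A :: "('m, real^2) chart set"
begin

lemma slit_chart_dom: "u \<in> fst (slit_chart A c) \<longleftrightarrow>
    fst u \<in> fst c \<and> snd u \<in> tangent_space A (fst u) \<and> snd u \<noteq> 0"
  by (cases u) (simp add: slit_chart_def)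

lemma slit_chart_coord: "snd (slit_chart A c) u = (snd c (fst u), \<chi> i. snd u (\<lambda>q. snd c q $ i))"
  by (cases u) (simp add: slit_chart_def)

lemma fibre_coord:
  assumes "c \<in> A" "p \<in> fst c"
  shows "(\<chi> i. coord_vec A c e p (\<lambda>q. snd c q $ i)) = e"
  using coord_vec_linear_coord[OF bounded_linear_vec_nth assms, of e] by simp

lemma tangent_vector_fibre_coord:
  assumes "c \<in> A" "p \<in> fst c" "v \<in> tangent_space A p"
  shows "coord_vec A c (\<chi> i. v (\<lambda>q. snd c q $ i)) p = v"
  using assms tangent_space_chart fibre_coord by fastforce

text \<open>The image over a subset \<open>D\<close> of the base is what is needed for the domain of a transition map; a
  tangent vector is nonzero exactly when its component vector is.\<close>

lemma slit_chart_image: 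
  assumes c: "c \<in> A"
  shows "snd (slit_chart A c) ` {u \<in> fst (slit_chart A c). fst u \<in> D} = (snd c ` (fst c \<inter> D)) \<times> (- {0})"
proof (intro equalityI subsetI)
  fix z assume "z \<in> snd (slit_chart A c) ` {u \<in> fst (slit_chart A c). fst u \<in> D}"
  then obtain u where u: "u \<in> fst (slit_chart A c)" "fst u \<in> D" "z = snd (slit_chart A c) u" by auto
  have "(\<chi> i. snd u (\<lambda>q. snd c q $ i)) \<noteq> 0"
    using tangent_vector_fibre_coord[OF c, of "fst u" "snd u"] u zero_coord_vec_iff[OF c, of "fst u" 0]
    by (auto simp: slit_chart_dom)
  then show "z \<in> (snd c ` (fst c \<inter> D)) \<times> (- {0})"
    using u by (auto simp: slit_chart_dom slit_chart_coord)
next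
  fix z assume "z \<in> (snd c ` (fst c \<inter> D)) \<times> (- {0 :: real^2})"
  then obtain p e where p: "p \<in> fst c" "p \<in> D" "e \<noteq> 0" "z = (snd c p, e)" by auto
  then have "(p, coord_vec A c e p) \<in> fst (slit_chart A c)"
    using c by (auto simp: slit_chart_dom tangent_space_chart zero_coord_vec_iff)
  moreover have "snd (slit_chart A c) (p, coord_vec A c e p) = z"
    using p c by (simp add: slit_chart_coord fibre_coord)
  ultimately show "z \<in> snd (slit_chart A c) ` {u \<in> fst (slit_chart A c). fst u \<in> D}"
    using p by (intro image_eqI[of _ _ "(p, coord_vec A c e p)"]) auto
qed

lemma slit_chart_range: "c \<in> A \<Longrightarrow> snd (slit_chart A c) ` fst (slit_chart A c) = (snd c ` fst c) \<times> (- {0})"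
  using slit_chart_image[of c UNIV] by simp

lemma inj_slit_chart: "c \<in> A \<Longrightarrow> inj_on (snd (slit_chart A c)) (fst (slit_chart A c))"
proof (rule inj_onI)
  fix u w assume c: "c \<in> A" and u: "u \<in> fst (slit_chart A c)" and w: "w \<in> fst (slit_chart A c)"
    and eq: "snd (slit_chart A c) u = snd (slit_chart A c) w"
  have 1: "fst u = fst w"
    using inj_onD[OF inj_chart[OF c]] u w eq by (simp add: slit_chart_dom slit_chart_coord)
  have y: "(\<chi> i. snd u (\<lambda>q. snd c q $ i)) = (\<chi> i. snd w (\<lambda>q. snd c q $ i))"
    using arg_cong[OF eq, of snd] by (simp only: slit_chart_coord snd_conv)
  have "snd u = coord_vec A c (\<chi> i. snd u (\<lambda>q. snd c q $ i)) (fst u)"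
    using u by (auto simp only: slit_chart_dom intro!: tangent_vector_fibre_coord[OF c, symmetric])
  also have "\<dots> = coord_vec A c (\<chi> i. snd w (\<lambda>q. snd c q $ i)) (fst w)" unfolding y 1 ..
  also have "\<dots> = snd w"
    using w by (auto simp only: slit_chart_dom intro!: tangent_vector_fibre_coord[OF c])
  finally have "snd u = snd w" .
  with 1 show "u = w" by (simp add: prod_eq_iff)
qed

lemma slit_chart_inv:
  assumes c: "c \<in> A" "p \<in> fst c" and e: "e \<noteq> 0"
  shows "chart_inv (slit_chart A c) (snd c p, e) = (p, coord_vec A c e p)"
proof -
  have "(p, coord_vec A c e p) \<in> fst (slit_chart A c)"
    using c e by (auto simp: slit_chart_dom tangent_space_chart zero_coord_vec_iff)
  from inv_into_f_f[OF inj_slit_chart[OF c(1)] this] show ?thesis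
    using c by (simp add: chart_inv_def slit_chart_coord fibre_coord)
qed

text \<open>Fibre coordinates transform by the derivative of the transition map of the base.\<close>

lemma slit_transition:
  assumes c: "c \<in> A" and d: "d \<in> A" and x: "x \<in> snd c ` (fst c \<inter> fst d)" and y: "y \<noteq> 0"
  shows "snd (slit_chart A d) (chart_inv (slit_chart A c) (x, y)) =
    ((snd d \<circ> chart_inv c) x, frechet_derivative (snd d \<circ> chart_inv c) (at x) y)"
proof -
  obtain p where p: "p \<in> fst c" "p \<in> fst d" "x = snd c p" using x by blast
  have "coord_vec A c y p = coord_vec A d (frechet_derivative (snd d \<circ> chart_inv c) (at x) y) p"
    using coord_vec_change_chart[OF d p(2) c p(1), of y] p(3) by simp
  then show ?thesis
    using slit_chart_inv[OF c p(1) y] p c fibre_coord[OF d p(2)] by (simp add: slit_chart_coord)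
qed

lemma chart_system_slit_atlas: "chart_system (slit_atlas A)"
proof
  fix c' d' assume "c' \<in> slit_atlas A" "d' \<in> slit_atlas A"
  then obtain c d where c: "c \<in> A" "c' = slit_chart A c" and d: "d \<in> A" "d' = slit_chart A d"
    unfolding slit_atlas_def by blast
  show "inj_on (snd c') (fst c')" using inj_slit_chart c by simp
  show "open (snd c' ` fst c')"
    using c open_image[OF c(1)] by (simp add: slit_chart_range open_Times open_Compl)
  let ?U = "snd c ` (fst c \<inter> fst d)" and ?\<tau> = "snd d \<circ> chart_inv c"
  let ?W = "?U \<times> (- {0}) :: ((real^2) \<times> (real^2)) set"
  have "fst c' \<inter> fst d' = {u \<in> fst (slit_chart A c). fst u \<in> fst d}"
    using c d by (auto simp: slit_chart_dom)
  then have W: "snd c' ` (fst c' \<inter> fst d') = ?W"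
    using slit_chart_image[OF c(1)] c by simp
  have \<tau>: "smooth_on ?U ?\<tau>" using smooth_transition c d by blast
  have oW: "open ?W" using smooth_on_open[OF \<tau>] by (simp add: open_Times open_Compl)
  have f: "smooth_on ?W fst" and s: "smooth_on ?W snd"
    using smooth_on_linear[OF oW] bounded_linear_fst bounded_linear_snd by blast+
  have 1: "smooth_on ?W (\<lambda>z. ?\<tau> (fst z))"
    by (rule smooth_on_compose[OF \<tau> f]) auto
  have 2: "smooth_on ?W (\<lambda>z. \<Sum>b\<in>Basis. (snd z \<bullet> b) *\<^sub>R frechet_derivative ?\<tau> (at (fst z)) b)"
    by (intro smooth_on_sum[OF oW] smooth_on_scaleR smooth_on_bilinear[OF bounded_bilinear_inner s smooth_on_const[OF oW]]
        smooth_on_compose[OF smooth_on_derivative[OF \<tau>] f]) auto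
  have l: "bounded_linear (\<lambda>x. (x::real^2, 0::real^2))" "bounded_linear (\<lambda>x. (0::real^2, x::real^2))"
    by (auto intro!: bounded_linear_Pair bounded_linear_ident bounded_linear_zero)
  have "smooth_on ?W (\<lambda>z. (?\<tau> (fst z), 0) +
      (0, \<Sum>b\<in>Basis. (snd z \<bullet> b) *\<^sub>R frechet_derivative ?\<tau> (at (fst z)) b))"
    by (rule smooth_on_add[OF smooth_on_compose_linear[OF l(1) 1] smooth_on_compose_linear[OF l(2) 2]])
  then show "smooth_on (snd c' ` (fst c' \<inter> fst d')) (snd d' \<circ> chart_inv c')"
    unfolding W
  proof (rule smooth_on_cong)
    fix z assume z: "z \<in> ?W"
    have "linear (frechet_derivative ?\<tau> (at (fst z)))"
      using z smooth_on_differentiable[OF \<tau>] linear_frechet_derivative by (metis mem_Times_iff)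
    note L = linear_Basis_sum[OF this, of "snd z"]
    have "snd d' (chart_inv c' (fst z, snd z)) = (?\<tau> (fst z), frechet_derivative ?\<tau> (at (fst z)) (snd z))"
      using slit_transition[OF c(1) d(1), of "fst z" "snd z"] z c d by (auto simp: mem_Times_iff)
    then show "(?\<tau> (fst z), 0) + (0, \<Sum>b\<in>Basis. (snd z \<bullet> b) *\<^sub>R frechet_derivative ?\<tau> (at (fst z)) b)
        = (snd d' \<circ> chart_inv c') z"
      by (simp only: L[symmetric]) simp
  qed
qed

end

sublocale base_surface \<subseteq> N: chart_system "slit_atlas A"
  by (rule chart_system_slit_atlas)

context base_surface
begin

lemma carrier_slit: "u \<in> carrier (slit_atlas A) \<longleftrightarrow>
    fst u \<in> carrier A \<and> snd u \<in> tangent_space A (fst u) \<and> snd u \<noteq> 0"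
  by (auto simp: carrier_def slit_atlas_def slit_chart_dom)

lemma chart_at:
  assumes "u \<in> carrier (slit_atlas A)"
  shows "chart_at A u \<in> A" "slit_chart A (chart_at A u) \<in> slit_atlas A"
    "u \<in> fst (slit_chart A (chart_at A u))"
proof -
  have "\<exists>c. c \<in> A \<and> fst u \<in> fst c" using assms unfolding carrier_slit by (auto simp: carrier_def)
  from someI_ex[OF this] have "chart_at A u \<in> A \<and> fst u \<in> fst (chart_at A u)"
    unfolding chart_at_def .
  with assms[unfolded carrier_slit] show "chart_at A u \<in> A" "slit_chart A (chart_at A u) \<in> slit_atlas A"
    "u \<in> fst (slit_chart A (chart_at A u))"
    by (auto simp: slit_chart_dom slit_atlas_def)
qed

lemma x_coord_eq: "x_coord c i = (\<lambda>u. fst (snd (slit_chart A c) u) $ i)"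
  and y_coord_eq: "y_coord c i = (\<lambda>u. snd (snd (slit_chart A c) u) $ i)"
  by (auto simp: x_coord_def y_coord_def slit_chart_coord split_beta)

lemma smooth_near_x_coord: "c \<in> A \<Longrightarrow> u \<in> fst (slit_chart A c) \<Longrightarrow> smooth_near (slit_atlas A) (x_coord c i) u"
  and smooth_near_y_coord: "c \<in> A \<Longrightarrow> u \<in> fst (slit_chart A c) \<Longrightarrow> smooth_near (slit_atlas A) (y_coord c i) u"
  unfolding x_coord_eq y_coord_eq
  by (rule N.smooth_near_linear_coord[of "\<lambda>z. fst z $ i"] N.smooth_near_linear_coord[of "\<lambda>z. snd z $ i"];
    auto simp: slit_atlas_def intro: bounded_linear_compose[OF bounded_linear_vec_nth bounded_linear_fst]
    bounded_linear_compose[OF bounded_linear_vec_nth bounded_linear_snd])+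

text \<open>In the chart of \<open>d\<close> the coordinates of \<open>c\<close> are \<open>\<tau>(x)\<close> and \<open>D\<tau>(x) y\<close>, where \<open>\<tau>\<close> is the transition map
  of the base. Only the vertical derivatives of the second one are needed, and they do not involve
  the derivative of \<open>D\<tau>\<close>.\<close>

lemma coord_vec_coord:
  assumes c: "c \<in> A" "u \<in> fst (slit_chart A c)" and d: "d \<in> A" "u \<in> fst (slit_chart A d)"
  shows "coord_vec (slit_atlas A) (slit_chart A d) e u (x_coord c i) =
      frechet_derivative (snd c \<circ> chart_inv d) (at (snd d (fst u))) (fst e) $ i"
    and "coord_vec (slit_atlas A) (slit_chart A d) (0, e') u (y_coord c i) =
      frechet_derivative (snd c \<circ> chart_inv d) (at (snd d (fst u))) e' $ i"
proof -
  let ?\<tau> = "snd c \<circ> chart_inv d" and ?x = "snd d (fst u)" and ?z = "snd (slit_chart A d) u"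
  let ?U = "snd d ` (fst d \<inter> fst c)"
  define y where "y = snd ?z"
  have z: "?z = (?x, y)" by (simp add: y_def slit_chart_coord)
  have \<tau>: "smooth_on ?U ?\<tau>" by (rule smooth_transition[OF d(1) c(1)])
  have xU: "?x \<in> ?U" using c d by (auto simp: slit_chart_dom)
  have "?z \<in> snd d ` fst d \<times> (- {0})" using slit_chart_range[OF d(1)] d(2) by blast
  then have y: "y \<noteq> 0" by (auto simp: z)
  have D: "(?\<tau> has_derivative frechet_derivative ?\<tau> (at ?x)) (at ?x)"
    by (rule smooth_on_has_derivative[OF \<tau> xU])
  let ?W = "?U \<times> (- {0}) :: ((real^2) \<times> (real^2)) set"
  have oW: "open ?W" using smooth_on_open[OF \<tau>] by (simp add: open_Times open_Compl)
  have zW: "?z \<in> ?W" using xU y by (simp add: z)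
  have t: "snd (slit_chart A c) (chart_inv (slit_chart A d) z) = (?\<tau> (fst z), frechet_derivative ?\<tau> (at (fst z)) (snd z))"
    if "z \<in> ?W" for z
    using slit_transition[OF d(1) c(1), of "fst z" "snd z"] that by (auto simp: mem_Times_iff)
  have "(fst has_derivative fst) (at ?z)"
    by (rule bounded_linear_imp_has_derivative[OF bounded_linear_fst])
  moreover have "(?\<tau> has_derivative frechet_derivative ?\<tau> (at ?x)) (at (fst ?z))"
    unfolding z fst_conv by (rule D)
  ultimately have "((\<lambda>z. ?\<tau> (fst z)) has_derivative (\<lambda>e. frechet_derivative ?\<tau> (at ?x) (fst e))) (at ?z)"
    by (rule has_derivative_compose)
  then have "((\<lambda>z. ?\<tau> (fst z) $ i) has_derivative (\<lambda>e. frechet_derivative ?\<tau> (at ?x) (fst e) $ i)) (at ?z)"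
    by (rule bounded_linear.has_derivative[OF bounded_linear_vec_nth])
  then have "(x_coord c i \<circ> chart_inv (slit_chart A d) has_derivative
      (\<lambda>e. frechet_derivative ?\<tau> (at ?x) (fst e) $ i)) (at ?z)"
    by (rule has_derivative_transform_within_open[OF _ oW zW]) (simp add: x_coord_eq t)
  then show "coord_vec (slit_atlas A) (slit_chart A d) e u (x_coord c i) =
      frechet_derivative ?\<tau> (at ?x) (fst e) $ i"
    using N.coord_vec_smooth[OF d(2) smooth_near_x_coord[OF c]] by (simp add: frechet_eqI)
  have sm: "smooth_near (slit_atlas A) (y_coord c i) u" by (rule smooth_near_y_coord[OF c])
  obtain W' where W': "?z \<in> W'" "smooth_on W' (y_coord c i \<circ> chart_inv (slit_chart A d))"
    using N.smooth_near_in_chart[OF sm _ d(2)] d(1) unfolding slit_atlas_def by blast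
  \<comment> \<open>On a line in the fibre over a fixed base point the fibre coordinates are an affine function of the
    parameter; its slope is the vertical derivative.\<close>
  have o: "open {s. (?x, y + s *\<^sub>R e') \<in> ?W}"
  proof -
    have "continuous_on UNIV (\<lambda>s. (?x, y + s *\<^sub>R e'))" by (intro continuous_intros)
    from open_vimage[OF oW this] show ?thesis by (simp add: vimage_def)
  qed
  let ?D = "frechet_derivative (y_coord c i \<circ> chart_inv (slit_chart A d)) (at ?z)"
  have "(y_coord c i \<circ> chart_inv (slit_chart A d) has_derivative ?D) (at (?z + 0 *\<^sub>R (0, e')))"
    using smooth_on_has_derivative[OF W'(2,1)] by (simp only: scaleR_zero_left add_0_right)
  from has_real_derivative_along_line[OF this]
  have 1: "((\<lambda>s. (y_coord c i \<circ> chart_inv (slit_chart A d)) (?z + s *\<^sub>R (0, e'))) has_real_derivative ?D (0, e')) (at 0)" .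
  have "((\<lambda>s. frechet_derivative ?\<tau> (at ?x) (y + s *\<^sub>R e') $ i) has_real_derivative
      frechet_derivative ?\<tau> (at ?x) e' $ i) (at 0)"
    by (rule has_real_derivative_along_line)
      (intro bounded_linear_imp_has_derivative bounded_linear_compose[OF bounded_linear_vec_nth]
        has_derivative_bounded_linear[OF D])
  then have 2: "((\<lambda>s. (y_coord c i \<circ> chart_inv (slit_chart A d)) (?z + s *\<^sub>R (0, e'))) has_real_derivative
      frechet_derivative ?\<tau> (at ?x) e' $ i) (at 0)"
    by (rule DERIV_cong_ev[THEN iffD1, rotated -1, OF _ refl _ refl])
      (use eventually_nhds_in_open[OF o, of 0] zW in \<open>auto elim!: eventually_mono simp: z y_coord_eq t\<close>)
  show "coord_vec (slit_atlas A) (slit_chart A d) (0, e') u (y_coord c i) =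
      frechet_derivative ?\<tau> (at ?x) e' $ i"
    using DERIV_unique[OF 1 2] N.coord_vec_smooth[OF d(2) sm] by simp
qed

section \<open>The almost-tangent structure and the Liouville field\<close>

lemma vertical_coord:
  assumes u: "u \<in> carrier (slit_atlas A)" and c: "c \<in> A" "u \<in> fst (slit_chart A c)"
  shows "(\<Sum>j\<in>UNIV. w $ j * d_y A (chart_at A u) j u (x_coord c i)) = 0"
    and "(\<Sum>j\<in>UNIV. w $ j * d_y A (chart_at A u) j u (y_coord c i)) =
      frechet_derivative (snd c \<circ> chart_inv (chart_at A u)) (at (snd (chart_at A u) (fst u))) w $ i"
proof -
  define d where "d = chart_at A u"
  have d: "d \<in> A" "u \<in> fst (slit_chart A d)" using chart_at[OF u] by (simp_all add: d_def)
  let ?D = "frechet_derivative (snd c \<circ> chart_inv d) (at (snd d (fst u)))"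
  have "snd d (fst u) \<in> snd d ` (fst d \<inter> fst c)" using c d by (auto simp: slit_chart_dom)
  then have L: "linear ?D"
    using smooth_on_differentiable[OF smooth_transition[OF d(1) c(1)]] linear_frechet_derivative by blast
  show "(\<Sum>j\<in>UNIV. w $ j * d_y A (chart_at A u) j u (x_coord c i)) = 0"
    using linear_0[OF L] by (simp add: d_def[symmetric] d_y_def coord_vec_coord(1)[OF c d])
  have "?D w = ?D (\<Sum>j\<in>UNIV. w $ j *\<^sub>R axis j 1)"
    using basis_expansion[of w] by (simp add: scalar_mult_eq_scaleR)
  also have "\<dots> = (\<Sum>j\<in>UNIV. w $ j *\<^sub>R ?D (axis j 1))"
    by (simp add: linear_sum[OF L] linear_cmul[OF L])
  finally have "?D w $ i = (\<Sum>j\<in>UNIV. w $ j * ?D (axis j 1) $ i)" by simp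
  then show "(\<Sum>j\<in>UNIV. w $ j * d_y A (chart_at A u) j u (y_coord c i)) =
      frechet_derivative (snd c \<circ> chart_inv (chart_at A u)) (at (snd (chart_at A u) (fst u))) w $ i"
    by (simp add: d_def[symmetric] d_y_def coord_vec_coord(2)[OF c d])
qed

text \<open>The operator \<open>J\<close> is defined in a chosen chart, while \<open>c\<close> is any chart around the base point. Both the
  components \<open>X(x\<^sup>i)\<close> and the fibre coordinates change by the same matrix \<open>D\<tau>\<close>, so the choice cancels.\<close>

lemma almost_tangent_coord:
  assumes u: "u \<in> carrier (slit_atlas A)" and c: "c \<in> A" "u \<in> fst (slit_chart A c)"
  shows "almost_tangent A X u (x_coord c i) = 0"
    and "X u \<in> tangent_space (slit_atlas A) u \<Longrightarrow> almost_tangent A X u (y_coord c i) = X u (x_coord c i)"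
proof -
  define d where "d = chart_at A u"
  have d: "d \<in> A" "u \<in> fst (slit_chart A d)" and d': "slit_chart A d \<in> slit_atlas A"
    using chart_at[OF u] by (simp_all add: d_def)
  define w where "w = (\<chi> j. X u (x_coord d j))"
  have J: "almost_tangent A X u f = (\<Sum>j\<in>UNIV. w $ j * d_y A d j u f)" for f
    by (simp add: almost_tangent_def d_def w_def Let_def)
  show "almost_tangent A X u (x_coord c i) = 0"
    unfolding J d_def by (rule vertical_coord(1)[OF u c])
  assume "X u \<in> tangent_space (slit_atlas A) u"
  then obtain e where e: "X u = coord_vec (slit_atlas A) (slit_chart A d) e u"
    unfolding N.tangent_space_chart[OF d' d(2)] by blast
  have "X u (x_coord d j) = fst e $ j" for j
    unfolding e x_coord_eq
    by (rule N.coord_vec_linear_coord[OF _ d' d(2)])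
      (rule bounded_linear_compose[OF bounded_linear_vec_nth bounded_linear_fst])
  then have w: "w = fst e" by (simp add: w_def vec_eq_iff)
  show "almost_tangent A X u (y_coord c i) = X u (x_coord c i)"
    unfolding J unfolding d_def vertical_coord(2)[OF u c] unfolding d_def[symmetric]
    by (simp add: e coord_vec_coord(1)[OF c d] w)
qed

text \<open>The vector of fibre coordinates itself transforms by \<open>D\<tau>\<close>, which is the matrix of the vertical derivatives.\<close>

lemma liouville_coord:
  assumes u: "u \<in> carrier (slit_atlas A)" and c: "c \<in> A" "u \<in> fst (slit_chart A c)"
  shows "liouville A u (x_coord c i) = 0" and "liouville A u (y_coord c i) = y_coord c i u"
proof -
  define d where "d = chart_at A u"
  have d: "d \<in> A" "u \<in> fst (slit_chart A d)" and d': "slit_chart A d \<in> slit_atlas A"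
    using chart_at[OF u] by (simp_all add: d_def)
  define w where "w = (\<chi> j. y_coord d j u)"
  have J: "liouville A u f = (\<Sum>j\<in>UNIV. w $ j * d_y A d j u f)" for f
    by (simp add: liouville_def d_def w_def Let_def)
  show "liouville A u (x_coord c i) = 0"
    unfolding J d_def by (rule vertical_coord(1)[OF u c])
  have z: "snd (slit_chart A d) u = (snd d (fst u), w)"
    by (simp add: w_def slit_chart_coord y_coord_eq)
  have "snd (slit_chart A d) u \<in> snd d ` fst d \<times> (- {0})" using slit_chart_range[OF d(1)] d(2) by blast
  then have w0: "w \<noteq> 0" by (simp add: z)
  have "snd d (fst u) \<in> snd d ` (fst d \<inter> fst c)" using c d by (auto simp: slit_chart_dom)
  from slit_transition[OF d(1) c(1) this w0]
  have "snd (snd (slit_chart A c) u) = frechet_derivative (snd c \<circ> chart_inv d) (at (snd d (fst u))) w"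
    using N.chart_inv[OF d' d(2)] by (simp add: z)
  then show "liouville A u (y_coord c i) = y_coord c i u"
    unfolding J unfolding d_def vertical_coord(2)[OF u c] unfolding d_def[symmetric]
    by (simp add: y_coord_eq)
qed

lemma almost_tangent_outside: "X u = 0 \<Longrightarrow> almost_tangent A X u = 0"
  by (simp add: almost_tangent_def fun_eq_iff)

lemma almost_tangent_twice:
  assumes "vector_field (slit_atlas A) X"
  shows "almost_tangent A (almost_tangent A X) = 0"
proof
  fix u
  show "almost_tangent A (almost_tangent A X) u = 0 u"
  proof (cases "u \<in> carrier (slit_atlas A)")
    case True
    then show ?thesis
      using almost_tangent_coord(1)[OF True chart_at(1,3)[OF True]]
      by (simp add: almost_tangent_def[of A "almost_tangent A X"] fun_eq_iff)
  next
    case False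
    then have "X u = 0" using assms unfolding vector_field_def by blast
    then show ?thesis by (simp add: almost_tangent_outside)
  qed
qed

text \<open>The bracket is tested on coordinates. On \<open>x\<^sup>i\<close> both fields vanish. On \<open>y\<^sup>i\<close> it is
  \<open>C(X(x\<^sup>i)) - X(x\<^sup>i)\<close>, by the coordinate values of \<open>JX\<close> and \<open>C\<close>, and this is zero because \<open>[C, X] = X\<close> is
  evaluated on \<open>x\<^sup>i\<close>, where \<open>C\<close> vanishes. In the frame below it yields \<open>[C, V] = 0\<close>.\<close>

lemma lie_liouville_vertical:
  assumes X: "vector_field (slit_atlas A) X" and V: "vector_field (slit_atlas A) (almost_tangent A X)"
    and C: "vector_field (slit_atlas A) (liouville A)" and CX: "lie (slit_atlas A) (liouville A) X = X"
  shows "lie (slit_atlas A) (liouville A) (almost_tangent A X) = 0"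
proof (intro ext)
  fix u f
  let ?N = "slit_atlas A" and ?V = "almost_tangent A X" and ?C = "liouville A"
  show "lie ?N ?C ?V u f = 0 u f"
  proof (cases "u \<in> carrier ?N")
    case False
    then have "\<not> smooth_near ?N f u" using N.smooth_near_carrier by blast
    then show ?thesis by (simp add: lie_def)
  next
    case u: True
    define c where "c = chart_at A u"
    have c: "c \<in> A" "u \<in> fst (slit_chart A c)" and c': "slit_chart A c \<in> ?N"
      using chart_at[OF u] by (simp_all add: c_def)
    have dC: "derivation ?N u (?C u)" and dV: "derivation ?N u (?V u)" and dX: "derivation ?N u (X u)"
      using N.vector_field_derivation_field[OF C] N.vector_field_derivation_field[OF V]
        N.vector_field_derivation_field[OF X]
      unfolding derivation_field_def by blast+
    have sm: "smooth_near ?N (vapply Y f) u" if "vector_field ?N Y" "smooth_near ?N f u" for Y f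
      using that unfolding vector_field_def vapply_def by blast
    have nr: "near ?N u P" if "\<And>q. q \<in> carrier ?N \<Longrightarrow> q \<in> fst (slit_chart A c) \<Longrightarrow> P q" for P
      by (rule N.near_mono[OF N.near_chart[OF c' c(2)]]) (use that c' in \<open>auto simp: carrier_def\<close>)
    note sx = smooth_near_x_coord[OF c] and sy = smooth_near_y_coord[OF c]
    have vanish: "v (vapply Y f) = 0"
      if "derivation ?N u v" "vector_field ?N Y" "smooth_near ?N f u"
        "\<And>q. q \<in> carrier ?N \<Longrightarrow> q \<in> fst (slit_chart A c) \<Longrightarrow> Y q f = 0" for v Y f
    proof -
      have "v (vapply Y f) = v (\<lambda>_. 0)"
        by (rule N.derivation_local[OF that(1) sm[OF that(2,3)] nr]) (simp add: vapply_def that(4))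
      then show ?thesis using N.derivation_const[OF that(1)] by simp
    qed
    have x0: "lie ?N ?C ?V u (x_coord c i) = 0" for i
    proof -
      have "?C u (vapply ?V (x_coord c i)) = 0"
        by (rule vanish[OF dC V sx]) (rule almost_tangent_coord(1)[OF _ c(1)])
      moreover have "?V u (vapply ?C (x_coord c i)) = 0"
        by (rule vanish[OF dV C sx]) (rule liouville_coord(1)[OF _ c(1)])
      ultimately show ?thesis by (simp add: lie_def)
    qed
    have y0: "lie ?N ?C ?V u (y_coord c i) = 0" for i
    proof -
      have "?C u (vapply X (x_coord c i)) = ?C u (vapply ?V (y_coord c i))"
      proof (rule N.derivation_local[OF dC sm[OF X sx] nr])
        fix q assume q: "q \<in> carrier ?N" "q \<in> fst (slit_chart A c)"
        then have "X q \<in> tangent_space ?N q" using X unfolding vector_field_def by blast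
        from almost_tangent_coord(2)[OF q(1) c(1) q(2), of X, OF this]
        show "vapply X (x_coord c i) q = vapply ?V (y_coord c i) q" by (simp add: vapply_def)
      qed
      moreover have "?V u (vapply ?C (y_coord c i)) = ?V u (y_coord c i)"
        by (rule N.derivation_local[OF dV sm[OF C sy] nr])
          (use liouville_coord(2)[OF _ c(1)] in \<open>simp add: vapply_def\<close>)
      moreover have "?V u (y_coord c i) = X u (x_coord c i)"
        using almost_tangent_coord(2)[OF u c] X u unfolding vector_field_def by blast
      moreover have "X u (vapply ?C (x_coord c i)) = 0"
        by (rule vanish[OF dX C sx]) (rule liouville_coord(1)[OF _ c(1)])
      moreover have "lie ?N ?C X u (x_coord c i) = X u (x_coord c i)" using CX by simp
      ultimately show ?thesis using sx sy by (simp add: lie_def)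
    qed
    have xb: "(\<lambda>q. snd (slit_chart A c) q \<bullet> (axis i 1, 0)) = x_coord c i"
      and yb: "(\<lambda>q. snd (slit_chart A c) q \<bullet> (0, axis i 1)) = y_coord c i" for i
      by (simp_all add: x_coord_eq y_coord_eq fun_eq_iff inner_prod_def inner_axis)
    have "lie ?N ?C ?V u (\<lambda>q. snd (slit_chart A c) q \<bullet> b) = 0" if "b \<in> Basis" for b
      using that x0 y0 xb yb by (auto simp: Basis_prod_def Basis_vec_def simp del: inner_Pair)
    then show ?thesis
      using N.lie_in_coordinates[OF C V c' c(2), of f] by simp
  qed
qed

end

section \<open>Brackets of combinations of the Berwald frame\<close>

text \<open>The spray conditions \<open>JS = C\<close>, \<open>[C, S] = S\<close> and the properties of the Berwald frame that determine the
  curvature. The relation \<open>[C, V] = 0\<close>, the homogeneity of \<open>\<I>\<close> and \<open>\<J>\<close> and the value of \<open>V(\<rho>)\<close> are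
  consequences.\<close>

locale berwald_structure = base_surface A for A :: "('m, real^2) chart set" +
  fixes S H V C :: "'m tpoint vfield" and \<rho> \<I> \<J> :: "'m tpoint \<Rightarrow> real"
  assumes field_H: "vector_field (slit_atlas A) H" and field_S: "vector_field (slit_atlas A) S"
    and field_V: "vector_field (slit_atlas A) V" and field_C: "vector_field (slit_atlas A) C"
    and J_H: "almost_tangent A H = V" and J_S: "almost_tangent A S = C"
    and C: "C = liouville A"
    and smooth_I: "smooth_fun (slit_atlas A) \<I>" and J: "\<J> = vapply S \<I>"
    and smooth_rho: "smooth_fun (slit_atlas A) \<rho>"
    and lie_SH: "lie (slit_atlas A) S H = \<rho> \<cdot> V" and lie_VS: "lie (slit_atlas A) V S = H"
    and lie_HV: "lie (slit_atlas A) H V = S + \<I> \<cdot> H + \<J> \<cdot> V"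
    and lie_CH: "lie (slit_atlas A) C H = H" and lie_CS: "lie (slit_atlas A) C S = S"
    and independent: "\<And>u a b c d. u \<in> carrier (slit_atlas A) \<Longrightarrow>
      (\<And>f. a * H u f + b * S u f + c * V u f + d * C u f = 0) \<Longrightarrow> a = 0 \<and> b = 0 \<and> c = 0 \<and> d = (0::real)"
begin

abbreviation "N \<equiv> slit_atlas A"

text \<open>Fields with smooth coefficients in the frame \<open>(H, S, V, C)\<close>. All operators in the definition of the
  Berwald connection act on them by explicit formulas in the four coefficients, so that the
  curvature can be evaluated on arbitrary fields without a separate proof that it is tensorial.\<close>

definition comb :: "('m tpoint \<Rightarrow> real) \<Rightarrow> ('m tpoint \<Rightarrow> real) \<Rightarrow> ('m tpoint \<Rightarrow> real) \<Rightarrow>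
    ('m tpoint \<Rightarrow> real) \<Rightarrow> 'm tpoint vfield" where
  "comb a b c d = (\<lambda>u f. a u * H u f + b u * S u f + c u * V u f + d u * C u f)"

lemma derivation_H: "derivation N u (H u)" and derivation_S: "derivation N u (S u)"
  and derivation_V: "derivation N u (V u)" and derivation_C: "derivation N u (C u)"
  using N.vector_field_derivation_field field_H field_S field_V field_C
  unfolding derivation_field_def by blast+

lemma derivation_comb: "derivation N u (comb a b c d u)"
proof -
  have "derivation N u (\<lambda>f. 1 * (a u * H u f + b u * S u f) + 1 * (c u * V u f + d u * C u f))"
    by (intro N.derivation_combination derivation_H derivation_S derivation_V derivation_C)
  then show ?thesis by (simp add: comb_def add.assoc)
qed

lemma derivation_field_comb:
  assumes "smooth_fun N a" "smooth_fun N b" "smooth_fun N c" "smooth_fun N d"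
  shows "derivation_field N (comb a b c d)"
  unfolding derivation_field_def
proof (intro conjI allI impI derivation_comb)
  fix f u assume f: "smooth_near N f u"
  have s: "smooth_near N (\<lambda>q. X q f) u" if "vector_field N X" for X
    using that f unfolding vector_field_def by blast
  have "u \<in> carrier N" by (rule N.smooth_near_carrier[OF f])
  then show "smooth_near N (vapply (comb a b c d) f) u"
    unfolding vapply_def comb_def
    by (intro N.smooth_near_add N.smooth_near_mult s field_H field_S field_V field_C smooth_funD assms)
qed

lemmas smooth_intros = N.smooth_fun_const N.smooth_fun_add N.smooth_fun_mult N.smooth_fun_uminus
  N.smooth_fun_diff smooth_I smooth_rho
  N.smooth_fun_field[OF N.vector_field_derivation_field[OF field_H]]
  N.smooth_fun_field[OF N.vector_field_derivation_field[OF field_S]]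
  N.smooth_fun_field[OF N.vector_field_derivation_field[OF field_V]]
  N.smooth_fun_field[OF N.vector_field_derivation_field[OF field_C]]
  N.smooth_fun_field[OF derivation_field_comb]

lemma smooth_J: "smooth_fun N \<J>"
  unfolding J vapply_def by (intro smooth_intros)

lemma comb_cong:
  assumes "\<And>u. u \<in> carrier N \<Longrightarrow> a u = a' u \<and> b u = b' u \<and> c u = c' u \<and> d u = d' u"
  shows "comb a b c d = comb a' b' c' d'"
proof (intro ext)
  fix u f
  show "comb a b c d u f = comb a' b' c' d' u f"
  proof (cases "u \<in> carrier N")
    case True
    then show ?thesis using assms by (simp add: comb_def)
  next
    case False
    then have "H u = 0" "S u = 0" "V u = 0" "C u = 0"
      using field_H field_S field_V field_C unfolding vector_field_def by blast+
    then show ?thesis by (simp add: comb_def)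
  qed
qed

lemma comb_eqD:
  assumes "comb a b c d u = comb a' b' c' d' u" "u \<in> carrier N"
  shows "a u = a' u \<and> b u = b' u \<and> c u = c' u \<and> d u = d' u"
proof -
  have "a u - a' u = 0 \<and> b u - b' u = 0 \<and> c u - c' u = 0 \<and> d u - d' u = 0"
  proof (rule independent[OF assms(2)])
    fix f
    show "(a u - a' u) * H u f + (b u - b' u) * S u f + (c u - c' u) * V u f + (d u - d' u) * C u f = 0"
      using fun_cong[OF assms(1), of f] by (simp add: comb_def algebra_simps)
  qed
  then show ?thesis by simp
qed

lemma lie_CV: "lie N C V = 0"
  using lie_liouville_vertical[OF field_H] field_V field_C lie_CH unfolding J_H C by blast

text \<open>The Leibniz rule, with the structure functions of the frame read off from its six brackets.\<close>

lemma lie_comb: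
  assumes a: "smooth_fun N a1" "smooth_fun N a2" "smooth_fun N a3" "smooth_fun N a4"
    and b: "smooth_fun N b1" "smooth_fun N b2" "smooth_fun N b3" "smooth_fun N b4"
  defines "X \<equiv> comb a1 a2 a3 a4" and "Y \<equiv> comb b1 b2 b3 b4"
  shows "lie N X Y = comb
    (\<lambda>u. X u b1 - Y u a1 + (a1 u * b3 u - b1 u * a3 u) * \<I> u - (a1 u * b4 u - b1 u * a4 u) - (a2 u * b3 u - b2 u * a3 u))
    (\<lambda>u. X u b2 - Y u a2 + (a1 u * b3 u - b1 u * a3 u) - (a2 u * b4 u - b2 u * a4 u))
    (\<lambda>u. X u b3 - Y u a3 - \<rho> u * (a1 u * b2 u - b1 u * a2 u) + (a1 u * b3 u - b1 u * a3 u) * \<J> u)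
    (\<lambda>u. X u b4 - Y u a4)"
proof (intro ext)
  fix u f
  show "lie N X Y u f = comb
    (\<lambda>u. X u b1 - Y u a1 + (a1 u * b3 u - b1 u * a3 u) * \<I> u - (a1 u * b4 u - b1 u * a4 u) - (a2 u * b3 u - b2 u * a3 u))
    (\<lambda>u. X u b2 - Y u a2 + (a1 u * b3 u - b1 u * a3 u) - (a2 u * b4 u - b2 u * a4 u))
    (\<lambda>u. X u b3 - Y u a3 - \<rho> u * (a1 u * b2 u - b1 u * a2 u) + (a1 u * b3 u - b1 u * a3 u) * \<J> u)
    (\<lambda>u. X u b4 - Y u a4) u f" (is "_ = ?R")
  proof (cases "smooth_near N f u")
    case False
    then have "?R = 0"
      using N.derivation_nonsmooth[OF derivation_comb False] by blast
    with False show ?thesis by (simp add: lie_def)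
  next
    case f: True
    have u: "u \<in> carrier N" by (rule N.smooth_near_carrier[OF f])
    have s: "smooth_near N (\<lambda>q. Z q f) u" if "vector_field N Z" for Z
      using that f unfolding vector_field_def by blast
    \<comment> \<open>A derivation is applied to a combination term by term; second derivatives remain on the frame fields only.\<close>
    have leibniz: "v (vapply (comb b1 b2 b3 b4) f) =
       (b1 u * v (\<lambda>q. H q f) + v b1 * H u f) + (b2 u * v (\<lambda>q. S q f) + v b2 * S u f) +
       (b3 u * v (\<lambda>q. V q f) + v b3 * V u f) + (b4 u * v (\<lambda>q. C q f) + v b4 * C u f)"
      if v: "derivation N u v" and b: "smooth_fun N b1" "smooth_fun N b2" "smooth_fun N b3" "smooth_fun N b4"
      for v b1 b2 b3 b4
    proof -
      have b': "smooth_near N b1 u" "smooth_near N b2 u" "smooth_near N b3 u" "smooth_near N b4 u"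
        using b u by (simp_all add: smooth_funD)
      note s' = s[OF field_H] s[OF field_S] s[OF field_V] s[OF field_C]
      show ?thesis
        unfolding vapply_def comb_def
        by (simp add: N.derivation_add[OF v] N.derivation_mult[OF v] N.smooth_near_add N.smooth_near_mult b' s')
    qed
    have e: "Z u (\<lambda>q. W q f) = W u (\<lambda>q. Z q f) + lie N Z W u f" for Z W
      using f by (simp add: lie_def vapply_def)
    \<comment> \<open>These rules order the compositions as \<open>H, S, V, C\<close>; the remaining second derivatives then cancel.
      One orientation deviates: \<open>H V\<close> is rewritten to \<open>V H\<close>, the direction in which that bracket is given.\<close>
    have 1: "S u (\<lambda>q. H q f) = H u (\<lambda>q. S q f) + \<rho> u * V u f"
      and 2: "V u (\<lambda>q. S q f) = S u (\<lambda>q. V q f) + H u f"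
      and 3: "H u (\<lambda>q. V q f) = V u (\<lambda>q. H q f) + (S u f + \<I> u * H u f + \<J> u * V u f)"
      and 4: "C u (\<lambda>q. H q f) = H u (\<lambda>q. C q f) + H u f"
      and 5: "C u (\<lambda>q. S q f) = S u (\<lambda>q. C q f) + S u f"
      and 6: "C u (\<lambda>q. V q f) = V u (\<lambda>q. C q f)"
      using e[of S H] e[of V S] e[of H V] e[of C H] e[of C S] e[of C V]
      unfolding lie_SH lie_VS lie_HV lie_CH lie_CS lie_CV by (simp_all add: vscale_def)
    have "lie N X Y u f = X u (vapply Y f) - Y u (vapply X f)" using f by (simp add: lie_def)
    also have "\<dots> = ?R"
      unfolding X_def Y_def leibniz[OF derivation_comb a] leibniz[OF derivation_comb b]
      unfolding comb_def 1 2 3 4 5 6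
      by (simp add: algebra_simps)
    finally show ?thesis .
  qed
qed

lemma unit_comb:
  "H = comb (\<lambda>_. 1) (\<lambda>_. 0) (\<lambda>_. 0) (\<lambda>_. 0)" "S = comb (\<lambda>_. 0) (\<lambda>_. 1) (\<lambda>_. 0) (\<lambda>_. 0)"
  "V = comb (\<lambda>_. 0) (\<lambda>_. 0) (\<lambda>_. 1) (\<lambda>_. 0)" "C = comb (\<lambda>_. 0) (\<lambda>_. 0) (\<lambda>_. 0) (\<lambda>_. 1)"
  by (simp_all add: comb_def fun_eq_iff)

lemma derivation_fields: "derivation_field N H" "derivation_field N S" "derivation_field N V" "derivation_field N C"
  using N.vector_field_derivation_field field_H field_S field_V field_C by blast+

lemma field_const: "H u (\<lambda>_. a) = 0" "S u (\<lambda>_. a) = 0" "V u (\<lambda>_. a) = 0" "C u (\<lambda>_. a) = 0"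
  "comb b c d e u (\<lambda>_. a) = 0"
  using N.derivation_const derivation_H derivation_S derivation_V derivation_C derivation_comb by blast+

lemma lie_frame_comb:
  "lie N H V = comb \<I> (\<lambda>_. 1) \<J> (\<lambda>_. 0)" "lie N S H = comb (\<lambda>_. 0) (\<lambda>_. 0) \<rho> (\<lambda>_. 0)"
  unfolding lie_HV lie_SH by (simp_all add: comb_def vscale_def fun_eq_iff)

lemma lie_comb_S:
  assumes "smooth_fun N a" "smooth_fun N b" "smooth_fun N c" "smooth_fun N d"
  shows "lie N (comb a b c d) S = comb (\<lambda>u. c u - S u a) (\<lambda>u. d u - S u b) (\<lambda>u. - S u c - \<rho> u * a u) (\<lambda>u. - S u d)"
  using lie_comb[of a b c d "\<lambda>_. 0" "\<lambda>_. 1" "\<lambda>_. 0" "\<lambda>_. 0"] assms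
  by (simp add: unit_comb[symmetric] smooth_intros field_const)

lemma lie_comb_V:
  assumes "smooth_fun N a" "smooth_fun N b" "smooth_fun N c" "smooth_fun N d"
  shows "lie N (comb a b c d) V = comb (\<lambda>u. - V u a + a u * \<I> u - b u) (\<lambda>u. - V u b + a u) (\<lambda>u. - V u c + a u * \<J> u) (\<lambda>u. - V u d)"
  using lie_comb[of a b c d "\<lambda>_. 0" "\<lambda>_. 0" "\<lambda>_. 1" "\<lambda>_. 0"] assms
  by (simp add: unit_comb[symmetric] smooth_intros field_const)

lemma lie_S_comb:
  assumes "smooth_fun N a" "smooth_fun N b" "smooth_fun N c" "smooth_fun N d"
  shows "lie N S (comb a b c d) = comb (\<lambda>u. S u a - c u) (\<lambda>u. S u b - d u) (\<lambda>u. S u c + \<rho> u * a u) (\<lambda>u. S u d)"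
  using lie_comb[of "\<lambda>_. 0" "\<lambda>_. 1" "\<lambda>_. 0" "\<lambda>_. 0" a b c d] assms
  by (simp add: unit_comb[symmetric] smooth_intros field_const)

lemma lie_C_comb:
  assumes "smooth_fun N a" "smooth_fun N b" "smooth_fun N c" "smooth_fun N d"
  shows "lie N C (comb a b c d) = comb (\<lambda>u. C u a + a u) (\<lambda>u. C u b + b u) (\<lambda>u. C u c) (\<lambda>u. C u d)"
  using lie_comb[of "\<lambda>_. 0" "\<lambda>_. 0" "\<lambda>_. 0" "\<lambda>_. 1" a b c d] assms
  by (simp add: unit_comb[symmetric] smooth_intros field_const)

text \<open>The \<open>V\<close>-component of the Jacobi identity for \<open>S\<close>, \<open>H\<close>, \<open>V\<close>.\<close>

lemma V_rho:
  assumes u: "u \<in> carrier N" shows "V u \<rho> = - (\<rho> u * \<I> u) - S u \<J>"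
proof -
  have SV: "lie N S V = comb (\<lambda>_. -1) (\<lambda>_. 0) (\<lambda>_. 0) (\<lambda>_. 0)"
    using lie_S_comb[of "\<lambda>_. 0" "\<lambda>_. 0" "\<lambda>_. 1" "\<lambda>_. 0"] by (simp add: unit_comb[symmetric] smooth_intros field_const)
  have HSV: "lie N H (lie N S V) = 0"
    using lie_comb[of "\<lambda>_. 1" "\<lambda>_. 0" "\<lambda>_. 0" "\<lambda>_. 0" "\<lambda>_. -1" "\<lambda>_. 0" "\<lambda>_. 0" "\<lambda>_. 0"]
    by (simp add: SV unit_comb[symmetric] smooth_intros field_const) (simp add: comb_def fun_eq_iff)
  have "lie N S (comb \<I> (\<lambda>_. 1) \<J> (\<lambda>_. 0)) =
      lie N (comb (\<lambda>_. 0) (\<lambda>_. 0) \<rho> (\<lambda>_. 0)) V"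
    using N.jacobi_identity[OF derivation_fields(2,1,3)] unfolding lie_frame_comb HSV by simp
  then have "comb (\<lambda>u. S u \<I> - \<J> u) (\<lambda>_. 0) (\<lambda>u. S u \<J> + \<rho> u * \<I> u) (\<lambda>_. 0) u =
      comb (\<lambda>_. 0) (\<lambda>_. 0) (\<lambda>u. - V u \<rho>) (\<lambda>_. 0) u"
    by (simp add: lie_S_comb lie_comb_V smooth_intros smooth_J field_const)
  from comb_eqD[OF this u] show ?thesis by linarith
qed

text \<open>The \<open>H\<close>- and \<open>V\<close>-components of the Jacobi identity for \<open>C\<close>, \<open>H\<close>, \<open>V\<close>, using \<open>[C, V] = 0\<close>.\<close>

lemma homogeneity:
  assumes u: "u \<in> carrier N" shows C_I: "C u \<I> = 0" and C_J: "C u \<J> = \<J> u"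
proof -
  have "lie N H 0 = 0"
    using field_const(1)[of _ 0] by (simp add: lie_def vapply_def fun_eq_iff)
  then have "lie N C (comb \<I> (\<lambda>_. 1) \<J> (\<lambda>_. 0)) = comb \<I> (\<lambda>_. 1) \<J> (\<lambda>_. 0)"
    using N.jacobi_identity[OF derivation_fields(4,1,3)] unfolding lie_CH lie_CV lie_frame_comb by simp
  then have "comb (\<lambda>u. C u \<I> + \<I> u) (\<lambda>_. 1) (\<lambda>u. C u \<J>) (\<lambda>_. 0) u = comb \<I> (\<lambda>_. 1) \<J> (\<lambda>_. 0) u"
    by (simp add: lie_C_comb smooth_intros smooth_J field_const)
  from comb_eqD[OF this u] show "C u \<I> = 0" "C u \<J> = \<J> u" by simp_all
qed

section \<open>The Berwald connection and its curvature\<close>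

text \<open>\<open>J\<close> is linear over functions and \<open>J\<^sup>2 = 0\<close>; its values on \<open>V = JH\<close> and \<open>C = JS\<close> are therefore zero.\<close>

lemma almost_tangent_comb: "almost_tangent A (comb a b c d) = comb (\<lambda>_. 0) (\<lambda>_. 0) a b"
proof (intro ext)
  fix u f
  have 0: "almost_tangent A V = 0" "almost_tangent A C = 0"
    unfolding J_H[symmetric] J_S[symmetric]
    by (rule almost_tangent_twice[OF field_H] almost_tangent_twice[OF field_S])+
  have "almost_tangent A (comb a b c d) u f = a u * almost_tangent A H u f + b u * almost_tangent A S u f
      + c u * almost_tangent A V u f + d u * almost_tangent A C u f"
    by (simp add: almost_tangent_def comb_def Let_def sum.distrib sum_distrib_left algebra_simps)
  then show "almost_tangent A (comb a b c d) u f = comb (\<lambda>_. 0) (\<lambda>_. 0) a b u f"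
    by (simp add: 0 J_H J_S comb_def)
qed

lemma comb_add: "comb a b c d + comb a' b' c' d' = comb (\<lambda>u. a u + a' u) (\<lambda>u. b u + b' u) (\<lambda>u. c u + c' u) (\<lambda>u. d u + d' u)"
  and comb_diff: "comb a b c d - comb a' b' c' d' = comb (\<lambda>u. a u - a' u) (\<lambda>u. b u - b' u) (\<lambda>u. c u - c' u) (\<lambda>u. d u - d' u)"
  and comb_scale: "k \<cdot> comb a b c d = comb (\<lambda>u. k u * a u) (\<lambda>u. k u * b u) (\<lambda>u. k u * c u) (\<lambda>u. k u * d u)"
  by (simp_all add: comb_def vscale_def fun_eq_iff algebra_simps)

text \<open>The derivatives \<open>S(a)\<close>, \<open>S(b)\<close> of the coefficients cancel between \<open>[JX, S]\<close> and \<open>J[X, S]\<close>.\<close>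

lemma hor_comb:
  assumes "smooth_fun N a" "smooth_fun N b" "smooth_fun N c" "smooth_fun N d"
  shows "hor A S (comb a b c d) = comb a b (\<lambda>_. 0) (\<lambda>_. 0)"
  using assms
  by (simp add: hor_def fn_right_def almost_tangent_comb lie_comb_S smooth_intros field_const
      comb_add comb_diff comb_scale)

lemma ver_comb:
  assumes "smooth_fun N a" "smooth_fun N b" "smooth_fun N c" "smooth_fun N d"
  shows "ver A S (comb a b c d) = comb (\<lambda>_. 0) (\<lambda>_. 0) c d"
  using assms
  by (simp add: ver_def fn_right_def almost_tangent_comb lie_comb_S smooth_intros field_const
      comb_add comb_diff comb_scale)

text \<open>The map \<open>\<theta>\<close> inverts \<open>J\<close> on vertical fields: \<open>\<theta>V = H\<close> and \<open>\<theta>C = S\<close>.\<close>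

lemma theta_comb:
  assumes "smooth_fun N a" "smooth_fun N b" "smooth_fun N c" "smooth_fun N d"
  shows "theta A S (comb a b c d) = comb c d (\<lambda>_. 0) (\<lambda>_. 0)"
  using assms
  by (simp add: theta_def fn_left_def hor_comb lie_S_comb smooth_intros field_const comb_diff)

text \<open>The connection forms of the frame: \<open>\<omega>\<^sup>1\<^sub>1 = \<J>\<eta>\<^sup>1 - \<I>\<eta>\<^sup>3 + \<eta>\<^sup>4\<close>, \<open>\<omega>\<^sup>2\<^sub>1 = -\<eta>\<^sup>3\<close>, \<open>\<omega>\<^sup>1\<^sub>2 = \<eta>\<^sup>3\<close> and
  \<open>\<omega>\<^sup>2\<^sub>2 = \<eta>\<^sup>4\<close>. On a horizontal field only the second and the fourth term of the definition of the
  connection contribute: they differentiate along the vertical and the horizontal part of the first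
  argument.\<close>

lemma berwald_conn_comb:
  assumes a: "smooth_fun N a1" "smooth_fun N a2" "smooth_fun N a3" "smooth_fun N a4"
    and p: "smooth_fun N p" "smooth_fun N q"
  shows "berwald_conn A S (comb a1 a2 a3 a4) (comb p q (\<lambda>_. 0) (\<lambda>_. 0)) =
    comb (\<lambda>u. comb a1 a2 a3 a4 u p + p u * (a1 u * \<J> u - a3 u * \<I> u + a4 u) + q u * a3 u)
         (\<lambda>u. comb a1 a2 a3 a4 u q - p u * a3 u + q u * a4 u) (\<lambda>_. 0) (\<lambda>_. 0)"
proof -
  note simps = hor_comb ver_comb theta_comb almost_tangent_comb lie_comb smooth_intros smooth_J field_const a p
  have 1: "ver A S (lie N (hor A S (comb a1 a2 a3 a4)) (ver A S (comb p q (\<lambda>_. 0) (\<lambda>_. 0)))) =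
      comb (\<lambda>_. 0) (\<lambda>_. 0) (\<lambda>_. 0) (\<lambda>_. 0)"
    by (simp add: simps)
  have 2: "hor A S (lie N (ver A S (comb a1 a2 a3 a4)) (hor A S (comb p q (\<lambda>_. 0) (\<lambda>_. 0)))) =
      comb (\<lambda>u. comb (\<lambda>_. 0) (\<lambda>_. 0) a3 a4 u p - p u * a3 u * \<I> u + p u * a4 u + q u * a3 u)
           (\<lambda>u. comb (\<lambda>_. 0) (\<lambda>_. 0) a3 a4 u q - p u * a3 u + q u * a4 u) (\<lambda>_. 0) (\<lambda>_. 0)"
    by (simp add: simps)
  have 3: "almost_tangent A (lie N (ver A S (comb a1 a2 a3 a4)) (theta A S (comb p q (\<lambda>_. 0) (\<lambda>_. 0)))) =
      comb (\<lambda>_. 0) (\<lambda>_. 0) (\<lambda>_. 0) (\<lambda>_. 0)"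
    by (simp add: simps)
  have 4: "theta A S (lie N (hor A S (comb a1 a2 a3 a4)) (almost_tangent A (comb p q (\<lambda>_. 0) (\<lambda>_. 0)))) =
      comb (\<lambda>u. comb a1 a2 (\<lambda>_. 0) (\<lambda>_. 0) u p + a1 u * p u * \<J> u)
           (\<lambda>u. comb a1 a2 (\<lambda>_. 0) (\<lambda>_. 0) u q) (\<lambda>_. 0) (\<lambda>_. 0)"
    by (simp add: simps)
  show ?thesis
    unfolding berwald_conn_def Let_def 1 2 3 4 comb_add
    by (rule comb_cong) (simp add: comb_def algebra_simps)
qed

text \<open>The structure equation \<open>\<Omega> = d\<omega> + \<omega> \<and> \<omega>\<close> for the connection forms above. The derivatives of the
  coefficients of the fields cancel, and so do \<open>H(\<J>)\<close> and \<open>V(\<I>)\<close> by antisymmetry. Of the other derivatives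
  along the frame, \<open>S(\<I>) = \<J>\<close> holds by definition, \<open>C(\<I>)\<close> and \<open>C(\<J>)\<close> are known by homogeneity, \<open>S(\<J>)\<close> combines
  with \<open>\<rho>\<I>\<close> to \<open>- V(\<rho>)\<close>, and what remains is \<open>H(\<I>) + V(\<J>)\<close>.\<close>

lemma berwald_curv_comb:
  assumes a: "smooth_fun N a1" "smooth_fun N a2" "smooth_fun N a3" "smooth_fun N a4"
    and b: "smooth_fun N b1" "smooth_fun N b2" "smooth_fun N b3" "smooth_fun N b4"
    and u: "u \<in> carrier N"
  defines "X \<equiv> comb a1 a2 a3 a4" and "Y \<equiv> comb b1 b2 b3 b4"
    and "w12 \<equiv> a1 u * b2 u - b1 u * a2 u" and "w13 \<equiv> a1 u * b3 u - b1 u * a3 u"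
  shows "berwald_curv A S X Y H u =
      comb (\<lambda>u. V u \<rho> * w12 - (H u \<I> + V u \<J>) * w13) (\<lambda>u. - \<rho> u * w12 + 2 * \<J> u * w13) (\<lambda>_. 0) (\<lambda>_. 0) u"
    and "berwald_curv A S X Y S u = comb (\<lambda>u. \<rho> u * w12) (\<lambda>_. 0) (\<lambda>_. 0) (\<lambda>_. 0) u"
proof -
  note sm = smooth_intros smooth_J a b
  have XI: "X u \<I> = a1 u * H u \<I> + a2 u * \<J> u + a3 u * V u \<I>"
    and YI: "Y u \<I> = b1 u * H u \<I> + b2 u * \<J> u + b3 u * V u \<I>"
    using C_I[OF u] by (simp_all add: X_def Y_def comb_def J vapply_def)
  have XJ: "X u \<J> = a1 u * H u \<J> + a2 u * S u \<J> + a3 u * V u \<J> + a4 u * \<J> u"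
    and YJ: "Y u \<J> = b1 u * H u \<J> + b2 u * S u \<J> + b3 u * V u \<J> + b4 u * \<J> u"
    using C_J[OF u] by (simp_all add: X_def Y_def comb_def)
  have dX: "derivation N u (X u)" and dY: "derivation N u (Y u)"
    by (simp_all add: X_def Y_def derivation_comb)
  note s = smooth_funD[OF _ u]
  have expand: "v (\<lambda>u. b1 u * \<J> u - b3 u * \<I> u + b4 u) =
      b1 u * v \<J> + v b1 * \<J> u - (b3 u * v \<I> + v b3 * \<I> u) + v b4" "v (\<lambda>u. - b3 u) = - v b3"
    if v: "derivation N u v" and "smooth_fun N b1" "smooth_fun N b3" "smooth_fun N b4" for v b1 b3 b4
    using that
    by (simp_all add: N.derivation_add[OF v] N.derivation_diff[OF v] N.derivation_mult[OF v]
      N.derivation_uminus[OF v] s smooth_intros smooth_J)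
  define c1 where "c1 = (\<lambda>u. X u b1 - Y u a1 + (a1 u * b3 u - b1 u * a3 u) * \<I> u - (a1 u * b4 u - b1 u * a4 u) - (a2 u * b3 u - b2 u * a3 u))"
  define c2 where "c2 = (\<lambda>u. X u b2 - Y u a2 + (a1 u * b3 u - b1 u * a3 u) - (a2 u * b4 u - b2 u * a4 u))"
  define c3 where "c3 = (\<lambda>u. X u b3 - Y u a3 - \<rho> u * (a1 u * b2 u - b1 u * a2 u) + (a1 u * b3 u - b1 u * a3 u) * \<J> u)"
  define c4 where "c4 = (\<lambda>u. X u b4 - Y u a4)"
  have lie: "lie N X Y = comb c1 c2 c3 c4"
    unfolding X_def Y_def c1_def c2_def c3_def c4_def by (rule lie_comb[OF a b])
  have c: "smooth_fun N c1" "smooth_fun N c2" "smooth_fun N c3" "smooth_fun N c4"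
    unfolding c1_def c2_def c3_def c4_def X_def Y_def by (intro sm)+
  have XY: "berwald_conn A S X (comb p q (\<lambda>_. 0) (\<lambda>_. 0)) =
      comb (\<lambda>u. X u p + p u * (a1 u * \<J> u - a3 u * \<I> u + a4 u) + q u * a3 u)
         (\<lambda>u. X u q - p u * a3 u + q u * a4 u) (\<lambda>_. 0) (\<lambda>_. 0)"
    "berwald_conn A S Y (comb p q (\<lambda>_. 0) (\<lambda>_. 0)) =
      comb (\<lambda>u. Y u p + p u * (b1 u * \<J> u - b3 u * \<I> u + b4 u) + q u * b3 u)
         (\<lambda>u. Y u q - p u * b3 u + q u * b4 u) (\<lambda>_. 0) (\<lambda>_. 0)"
    if "smooth_fun N p" "smooth_fun N q" for p q
    unfolding X_def Y_def by (rule berwald_conn_comb[OF a that] berwald_conn_comb[OF b that])+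
  have DH: "berwald_conn A S (comb a1 a2 a3 a4) H =
      comb (\<lambda>u. a1 u * \<J> u - a3 u * \<I> u + a4 u) (\<lambda>u. - a3 u) (\<lambda>_. 0) (\<lambda>_. 0)"
    and DS: "berwald_conn A S (comb a1 a2 a3 a4) S = comb a3 a4 (\<lambda>_. 0) (\<lambda>_. 0)"
    if "smooth_fun N a1" "smooth_fun N a2" "smooth_fun N a3" "smooth_fun N a4" for a1 a2 a3 a4
    using berwald_conn_comb[OF that, of "\<lambda>_. 1" "\<lambda>_. 0"] berwald_conn_comb[OF that, of "\<lambda>_. 0" "\<lambda>_. 1"]
    by (simp_all add: unit_comb[symmetric] smooth_intros field_const)
  \<comment> \<open>The components of \<open>D\<^sub>X D\<^sub>Y H - D\<^sub>Y D\<^sub>X H - D\<^bsub>[X,Y]\<^esub> H\<close> along \<open>H\<close> and \<open>S\<close>, as the formula for the connection gives them.\<close>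
  define P where "P = (\<lambda>u. X u (\<lambda>u. b1 u * \<J> u - b3 u * \<I> u + b4 u)
      + (b1 u * \<J> u - b3 u * \<I> u + b4 u) * (a1 u * \<J> u - a3 u * \<I> u + a4 u) + - b3 u * a3 u
      - (Y u (\<lambda>u. a1 u * \<J> u - a3 u * \<I> u + a4 u)
        + (a1 u * \<J> u - a3 u * \<I> u + a4 u) * (b1 u * \<J> u - b3 u * \<I> u + b4 u) + - a3 u * b3 u)
      - (c1 u * \<J> u - c3 u * \<I> u + c4 u))"
  define Q where "Q = (\<lambda>u. X u (\<lambda>u. - b3 u) - (b1 u * \<J> u - b3 u * \<I> u + b4 u) * a3 u + - b3 u * a4 u
      - (Y u (\<lambda>u. - a3 u) - (a1 u * \<J> u - a3 u * \<I> u + a4 u) * b3 u + - a3 u * b4 u) - - c3 u)"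
  have "berwald_curv A S X Y H = comb P Q (\<lambda>_. 0) (\<lambda>_. 0)"
    unfolding berwald_curv_def Let_def lie DH[OF c] unfolding X_def Y_def DH[OF a] DH[OF b]
    unfolding X_def[symmetric] Y_def[symmetric] P_def Q_def
    by (simp only: XY comb_diff sm diff_self)
  moreover have "P u = V u \<rho> * w12 - (H u \<I> + V u \<J>) * w13"
    unfolding P_def expand[OF dX b(1,3,4)] expand[OF dY a(1,3,4)] XI YI XJ YJ V_rho[OF u]
    unfolding c1_def c3_def c4_def w12_def w13_def
    by (simp add: algebra_simps)
  moreover have "Q u = - \<rho> u * w12 + 2 * \<J> u * w13"
    unfolding Q_def expand[OF dX b(1,3,4)] expand[OF dY a(1,3,4)] c3_def w12_def w13_def
    by (simp add: algebra_simps)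
  ultimately show "berwald_curv A S X Y H u = comb (\<lambda>u. V u \<rho> * w12 - (H u \<I> + V u \<J>) * w13)
      (\<lambda>u. - \<rho> u * w12 + 2 * \<J> u * w13) (\<lambda>_. 0) (\<lambda>_. 0) u"
    by (simp add: comb_def)
  have "berwald_curv A S X Y S = comb
      (\<lambda>u. X u b3 + b3 u * (a1 u * \<J> u - a3 u * \<I> u + a4 u) + b4 u * a3 u
        - (Y u a3 + a3 u * (b1 u * \<J> u - b3 u * \<I> u + b4 u) + a4 u * b3 u) - c3 u)
      (\<lambda>u. X u b4 - b3 u * a3 u + b4 u * a4 u - (Y u a4 - a3 u * b3 u + a4 u * b4 u) - c4 u) (\<lambda>_. 0) (\<lambda>_. 0)"
    unfolding berwald_curv_def Let_def lie DS[OF c] unfolding X_def Y_def DS[OF a] DS[OF b]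
    unfolding X_def[symmetric] Y_def[symmetric]
    by (simp only: XY comb_diff sm diff_self)
  then show "berwald_curv A S X Y S u = comb (\<lambda>u. \<rho> u * w12) (\<lambda>_. 0) (\<lambda>_. 0) (\<lambda>_. 0) u"
    by (simp add: comb_def c3_def c4_def w12_def algebra_simps)
qed

section \<open>The curvature forms\<close>

text \<open>This reduces the curvature of general fields to that of combinations: the frame provides coefficients
  point by point, and the dual forms identify them as smooth functions.\<close>

lemma vector_field_eq_comb:
  assumes span: "\<And>v u. u \<in> carrier N \<Longrightarrow> v \<in> tangent_space N u \<Longrightarrow>
      \<exists>a b c d. v = (\<lambda>f. a * H u f + b * S u f + c * V u f + d * C u f)"
    and dual: "\<And>u a b c d. u \<in> carrier N \<Longrightarrow>
      \<eta>1 u (comb a b c d u) = a u \<and> \<eta>2 u (comb a b c d u) = b u \<and>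
      \<eta>3 u (comb a b c d u) = c u \<and> \<eta>4 u (comb a b c d u) = d u"
    and X: "vector_field N X"
  shows "X = comb (\<lambda>u. \<eta>1 u (X u)) (\<lambda>u. \<eta>2 u (X u)) (\<lambda>u. \<eta>3 u (X u)) (\<lambda>u. \<eta>4 u (X u))"
    (is "X = ?Y")
proof
  fix u
  show "X u = ?Y u"
  proof (cases "u \<in> carrier N")
    case False
    then have "X u = 0" "H u = 0" "S u = 0" "V u = 0" "C u = 0"
      using X field_H field_S field_V field_C unfolding vector_field_def by blast+
    then show ?thesis by (simp add: comb_def fun_eq_iff)
  next
    case True
    then have "X u \<in> tangent_space N u" using X unfolding vector_field_def by blast
    then obtain a b c d where "X u = (\<lambda>f. a * H u f + b * S u f + c * V u f + d * C u f)"
      using span[OF True] by blast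
    then have Xu: "X u = comb (\<lambda>_. a) (\<lambda>_. b) (\<lambda>_. c) (\<lambda>_. d) u" by (simp add: comb_def)
    show ?thesis
      using dual[OF True, of "\<lambda>_. a" "\<lambda>_. b" "\<lambda>_. c" "\<lambda>_. d"]
      unfolding Xu[symmetric] by (simp add: Xu comb_def)
  qed
qed

end

lemma atLeastAtMost_1_4: "{1..4::nat} = {1, 2, 3, 4}"
  by auto

lemma berwald_fields_simps:
  "berwald_fields A H S V 1 = H" "berwald_fields A H S V 2 = S"
  "berwald_fields A H S V 3 = V" "berwald_fields A H S V 4 = liouville A"
  "berwald_fields A H S V (Suc 0) = H"
  by (simp_all add: berwald_fields_def numeral_eq_Suc)

theorem proposition3p12:
  fixes A :: "('m::{t2_space, second_countable_topology}, real^2) chart set"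
    and F K \<rho> \<I> \<J> :: "'m tpoint \<Rightarrow> real"
    and S H V :: "'m tpoint vfield"
    and E :: "nat \<Rightarrow> 'm tpoint vfield"
    and \<eta> :: "nat \<Rightarrow> 'm tpoint \<Rightarrow> 'm tpoint tvector \<Rightarrow> real"
    and \<Omega> :: "nat \<Rightarrow> nat \<Rightarrow> 'm tpoint vfield \<Rightarrow> 'm tpoint vfield \<Rightarrow> 'm tpoint \<Rightarrow> real"
    and \<F> :: "'m tpoint \<Rightarrow> real"
  assumes surface: "smooth_atlas A"
    and finsler: "finsler_function A F"
    and spray: "geodesic_spray A F S"
    and flag: "flag_curvature A F S K"
    and nonflat: "\<forall>u\<in>carrier (slit_atlas A). K u \<noteq> 0"
    and rho: "\<rho> = ricci_scalar F K"
    and berwald: "berwald_frame A F S \<rho> H V \<I> \<J>"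
    and E: "E = berwald_fields A H S V"
    and coframe: "dual_coframe (slit_atlas A) {1..4} E \<eta>"
    and Omega: "\<Omega> = curv_form A S E \<eta>"
    and calF: "\<F> = (\<lambda>u. H u \<I> + V u \<J>)"
  shows "\<forall>X Y. vector_field (slit_atlas A) X \<longrightarrow> vector_field (slit_atlas A) Y \<longrightarrow>
    (\<forall>u\<in>carrier (slit_atlas A).
       \<Omega> 1 1 X Y u = V u \<rho> * wedge (\<eta> 1) (\<eta> 2) X Y u - \<F> u * wedge (\<eta> 1) (\<eta> 3) X Y u \<and>
       \<Omega> 2 1 X Y u = - \<rho> u * wedge (\<eta> 1) (\<eta> 2) X Y u + 2 * \<J> u * wedge (\<eta> 1) (\<eta> 3) X Y u \<and>
       \<Omega> 1 2 X Y u = \<rho> u * wedge (\<eta> 1) (\<eta> 2) X Y u \<and>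
       \<Omega> 2 2 X Y u = 0)"
proof (intro allI impI ballI)
  fix X Y u
  assume X: "vector_field (slit_atlas A) X" and Y: "vector_field (slit_atlas A) Y"
    and u: "u \<in> carrier (slit_atlas A)"
  interpret base_surface A
    using chart_system_smooth_atlas[OF surface] by (simp add: base_surface_def)
  let ?N = "slit_atlas A"
  let ?C = "liouville A"
  have fr: "frame ?N {1..4} (berwald_fields A H S V)"
    using berwald unfolding berwald_frame_def Let_def by blast
  then have fields: "vector_field ?N H" "vector_field ?N S" "vector_field ?N V" "vector_field ?N ?C"
    unfolding frame_def atLeastAtMost_1_4 by (simp_all add: berwald_fields_simps)
  have sum4: "(\<Sum>i\<in>{1..4}. a i * berwald_fields A H S V i p f) =
      a 1 * H p f + a 2 * S p f + a 3 * V p f + a 4 * ?C p f" for a p f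
    unfolding atLeastAtMost_1_4 by (simp add: berwald_fields_simps add.assoc)
  have independent: "a = 0 \<and> b = 0 \<and> c = 0 \<and> d = 0"
    if p: "p \<in> carrier ?N" and z: "\<And>f. a * H p f + b * S p f + c * V p f + d * ?C p f = 0" for p a b c d
  proof -
    define k :: "nat \<Rightarrow> real" where "k = (\<lambda>i. if i = 1 then a else if i = 2 then b else if i = 3 then c else d)"
    have "\<forall>f. (\<Sum>i\<in>{1..4}. k i * berwald_fields A H S V i p f) = 0"
      unfolding sum4 using z by (simp add: k_def)
    then have "\<forall>i\<in>{1..4}. k i = 0" using fr p unfolding frame_def by blast
    then show ?thesis unfolding atLeastAtMost_1_4 by (simp add: k_def)
  qed
  have span: "\<exists>a b c d. v = (\<lambda>f. a * H p f + b * S p f + c * V p f + d * ?C p f)"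
    if "p \<in> carrier ?N" "v \<in> tangent_space ?N p" for p v
  proof -
    have "\<exists>a::nat \<Rightarrow> real. v = (\<lambda>f. \<Sum>i\<in>{1..4}. a i * berwald_fields A H S V i p f)"
      using fr that unfolding frame_def by blast
    then show ?thesis unfolding sum4 by blast
  qed
  have "smooth_fun ?N K" "smooth_fun ?N F"
    using flag finsler by (simp_all add: flag_curvature_def finsler_function_def)
  then have smooth_rho: "smooth_fun ?N \<rho>"
    unfolding rho ricci_scalar_def power2_eq_square by (intro N.smooth_fun_mult)
  have J_S: "almost_tangent A S = ?C" and CS: "lie ?N ?C S = S"
    using spray by (simp_all add: geodesic_spray_def spray_def)
  have J_H: "almost_tangent A H = V" and smooth_I: "smooth_fun ?N \<I>" and J: "\<J> = vapply S \<I>"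
    and brackets: "lie ?N S H = \<rho> \<cdot> V" "lie ?N V S = H" "lie ?N H V = S + \<I> \<cdot> H + \<J> \<cdot> V" "lie ?N ?C H = H"
    using berwald unfolding berwald_frame_def Let_def by blast+
  interpret berwald_structure A S H V ?C \<rho> \<I> \<J>
    by unfold_locales ((fact fields J_H J_S refl smooth_I J smooth_rho brackets CS) | (rule independent, assumption, blast))+
  have form: "one_form ?N (\<eta> i)" if "i \<in> {1..4}" for i
    using coframe that by (simp add: dual_coframe_def)
  have dual: "\<eta> i p (E j p) = (if i = j then 1 else 0)" if "p \<in> carrier ?N" "i \<in> {1..4}" "j \<in> {1..4}" for i j p
    using coframe that unfolding dual_coframe_def by blast
  have \<eta>_comb: "\<eta> 1 p (comb a b c d p) = a p \<and> \<eta> 2 p (comb a b c d p) = b p \<and>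
      \<eta> 3 p (comb a b c d p) = c p \<and> \<eta> 4 p (comb a b c d p) = d p" if p: "p \<in> carrier ?N" for p a b c d
  proof -
    have "\<eta> i p (comb a b c d p) = a p * \<eta> i p (H p) + b p * \<eta> i p (S p) + c p * \<eta> i p (V p) + d p * \<eta> i p (?C p)"
      if "i \<in> {1..4}" for i
      unfolding comb_def
      by (rule N.one_form_combination4[OF form[OF that] p])
        (use fields p in \<open>auto simp: vector_field_def\<close>)
    moreover have "\<eta> i p (H p) = (if i = 1 then 1 else 0)" "\<eta> i p (S p) = (if i = 2 then 1 else 0)"
      "\<eta> i p (V p) = (if i = 3 then 1 else 0)" "\<eta> i p (?C p) = (if i = 4 then 1 else 0)"
      if "i \<in> {1..4}" for i
      using dual[OF p that, of 1] dual[OF p that, of 2] dual[OF p that, of 3] dual[OF p that, of 4]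
      by (simp_all add: E berwald_fields_simps)
    ultimately show ?thesis by simp
  qed
  have smooth: "smooth_fun ?N (\<lambda>p. \<eta> i p (Z p))" if "vector_field ?N Z" "i \<in> {1..4}" for Z i
    using form[OF that(2)] that(1) unfolding one_form_def by blast
  have expand: "Z = comb (\<lambda>p. \<eta> 1 p (Z p)) (\<lambda>p. \<eta> 2 p (Z p)) (\<lambda>p. \<eta> 3 p (Z p)) (\<lambda>p. \<eta> 4 p (Z p))"
    if "vector_field ?N Z" for Z
    by (rule vector_field_eq_comb[OF span \<eta>_comb that])
  note Xc = expand[OF X] and Yc = expand[OF Y]
  note curv = berwald_curv_comb[OF smooth[OF X, of 1] smooth[OF X, of 2] smooth[OF X, of 3] smooth[OF X, of 4]
    smooth[OF Y, of 1] smooth[OF Y, of 2] smooth[OF Y, of 3] smooth[OF Y, of 4] u, folded Xc Yc, simplified]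
  show "\<Omega> 1 1 X Y u = V u \<rho> * wedge (\<eta> 1) (\<eta> 2) X Y u - \<F> u * wedge (\<eta> 1) (\<eta> 3) X Y u \<and>
       \<Omega> 2 1 X Y u = - \<rho> u * wedge (\<eta> 1) (\<eta> 2) X Y u + 2 * \<J> u * wedge (\<eta> 1) (\<eta> 3) X Y u \<and>
       \<Omega> 1 2 X Y u = \<rho> u * wedge (\<eta> 1) (\<eta> 2) X Y u \<and>
       \<Omega> 2 2 X Y u = 0"
    using curv \<eta>_comb[OF u]
    by (simp add: Omega curv_form_def E berwald_fields_simps wedge_def calF)
qed

end
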